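(* Let $A_\Gamma$ be an Artin group such that there exists a prime $p$ with $p\mid \frac{l(e)}{2}$ for every edge $e$ of $\Gamma$ with even label $l(e)>2$. Then for every nonzero character $\chi:A_\Gamma\to\mathbb{R}$, $[\chi]\in\Sigma^1(A_\Gamma,\mathbb{Z})$ if and only if $\mathrm{Liv}^\chi$ is connected and dominant.
   Context: $\Gamma$ is a finite simple graph with edge labels $l(e)\in\mathbb{Z}_{\ge2}$; $A_\Gamma=\langle V(\Gamma)\mid \langle u,v\rangle^{l(e)}=\langle v,u\rangle^{l(e)}\ \forall e=\{u,v\}\in E(\Gamma)\rangle$, $\langle u,v\rangle^m$ the alternating word $uvu\cdots$ of length $m$. A character is a homomorphism $\chi:A_\Gamma\to\mathbb{R}$, $[\chi]$ its class up to positive scaling. $\Sigma^1(G,\mathbb{Z})=\{[\chi]\mid\mathbb{Z}\text{ is of type }FP_1\text{ over }\mathbb{Z}G_\chi\}$ with $G_\chi=\{g\mid\chi(g)\ge0\}$. A vertex $v$ is dead if $\chi(v)=0$; an edge $e=\{u,v\}$ is dead if $l(e)>2$ is even and $\chi(u)+\chi(v)=0$. The living subgraph $\mathrm{Liv}^\chi$ is obtained from $\Gamma$ by removing all dead vertices (with incident edges) and the interiors of all dead edges. It is dominant if every vertex of $\Gamma$ not in $\mathrm{Liv}^\chi$ is adjacent in $\Gamma$ to some vertex of $\mathrm{Liv}^\chi$. *)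

theory Defs
  imports Complex_Main "HOL-Algebra.Group" "HOL-Computational_Algebra.Primes"
begin

definition labelled_graph :: "'v set \<Rightarrow> ('v \<Rightarrow> 'v \<Rightarrow> bool) \<Rightarrow> ('v \<Rightarrow> 'v \<Rightarrow> nat) \<Rightarrow> bool" where
  "labelled_graph V E lab \<longleftrightarrow> finite V \<and>
     (\<forall>u v. E u v \<longrightarrow> u \<in> V \<and> v \<in> V \<and> u \<noteq> v \<and> E v u \<and> lab u v = lab v u \<and> lab u v \<ge> 2)"

text \<open>Letters: (v, False) is the generator v, (v, True) its inverse.\<close>
definition alt_word :: "'v \<Rightarrow> 'v \<Rightarrow> nat \<Rightarrow> ('v \<times> bool) list" where
  "alt_word u v m = map (\<lambda>i. if even i then (u, False) else (v, False)) [0..<m]"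

inductive artin_rel :: "('v \<Rightarrow> 'v \<Rightarrow> bool) \<Rightarrow> ('v \<Rightarrow> 'v \<Rightarrow> nat) \<Rightarrow> ('v \<times> bool) list \<Rightarrow> ('v \<times> bool) list \<Rightarrow> bool"
  for E lab where
  ar_refl: "artin_rel E lab w w"
| ar_sym: "artin_rel E lab w w' \<Longrightarrow> artin_rel E lab w' w"
| ar_trans: "artin_rel E lab w w' \<Longrightarrow> artin_rel E lab w' w'' \<Longrightarrow> artin_rel E lab w w''"
| ar_cong: "artin_rel E lab w w' \<Longrightarrow> artin_rel E lab (a @ w @ b) (a @ w' @ b)"
| ar_cancel: "artin_rel E lab [(v, b), (v, \<not> b)] []"
| ar_braid: "E u v \<Longrightarrow> artin_rel E lab (alt_word u v (lab u v)) (alt_word v u (lab u v))"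

definition artin_class :: "('v \<Rightarrow> 'v \<Rightarrow> bool) \<Rightarrow> ('v \<Rightarrow> 'v \<Rightarrow> nat) \<Rightarrow> ('v \<times> bool) list \<Rightarrow> ('v \<times> bool) list set" where
  "artin_class E lab w = {w'. artin_rel E lab w w'}"

definition artin_group :: "'v set \<Rightarrow> ('v \<Rightarrow> 'v \<Rightarrow> bool) \<Rightarrow> ('v \<Rightarrow> 'v \<Rightarrow> nat) \<Rightarrow> ('v \<times> bool) list set monoid" where
  "artin_group V E lab =
     \<lparr> carrier = artin_class E lab ` lists (V \<times> UNIV),
       monoid.mult = (\<lambda>X Y. {w. \<exists>x\<in>X. \<exists>y\<in>Y. artin_rel E lab (x @ y) w}),
       one = artin_class E lab [] \<rparr>"

definition artin_gen :: "('v \<Rightarrow> 'v \<Rightarrow> bool) \<Rightarrow> ('v \<Rightarrow> 'v \<Rightarrow> nat) \<Rightarrow> 'v \<Rightarrow> ('v \<times> bool) list set" where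
  "artin_gen E lab v = artin_class E lab [(v, False)]"

definition character :: "('g, 'b) monoid_scheme \<Rightarrow> ('g \<Rightarrow> real) \<Rightarrow> bool" where
  "character G \<chi> \<longleftrightarrow> (\<forall>x\<in>carrier G. \<forall>y\<in>carrier G. \<chi> (x \<otimes>\<^bsub>G\<^esub> y) = \<chi> x + \<chi> y)"

text \<open>Elements of the monoid ring Z M (M a submonoid of G): finitely supported integer functions supported in M.\<close>
definition mr_elem :: "'g set \<Rightarrow> ('g \<Rightarrow> int) \<Rightarrow> bool" where
  "mr_elem M f \<longleftrightarrow> finite {x. f x \<noteq> 0} \<and> {x. f x \<noteq> 0} \<subseteq> M"

definition mr_mult :: "('g, 'b) monoid_scheme \<Rightarrow> ('g \<Rightarrow> int) \<Rightarrow> ('g \<Rightarrow> int) \<Rightarrow> 'g \<Rightarrow> int" where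
  "mr_mult G f h = (\<lambda>g. \<Sum>(a, b)\<in>{(a, b). f a \<noteq> 0 \<and> h b \<noteq> 0 \<and> a \<otimes>\<^bsub>G\<^esub> b = g}. f a * h b)"

definition mr_aug :: "('g \<Rightarrow> int) \<Rightarrow> int" where
  "mr_aug f = (\<Sum>g\<in>{x. f x \<noteq> 0}. f g)"

text \<open>The trivial module Z is of type FP_1 over Z M: there is an exact sequence
  F_1 \<rightarrow> F_0 \<rightarrow> Z \<rightarrow> 0 of left Z M-modules with F_1 = (Z M)^n1, F_0 = (Z M)^n0 finitely
  generated free.  A Z M-linear map F_1 \<rightarrow> F_0 is given by a matrix D (y \<mapsto> y D), and a
  Z M-linear map F_0 \<rightarrow> Z (trivial action) by integers c_j (x \<mapsto> sum_j aug(x_j) c_j).\<close>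
definition FP1_over :: "('g, 'b) monoid_scheme \<Rightarrow> 'g set \<Rightarrow> bool" where
  "FP1_over G M \<longleftrightarrow>
    (\<exists>(n0::nat) (n1::nat) (D::nat \<Rightarrow> nat \<Rightarrow> 'g \<Rightarrow> int) (c::nat \<Rightarrow> int).
      (\<forall>i<n1. \<forall>j<n0. mr_elem M (D i j)) \<and>
      (\<forall>z::int. \<exists>x. (\<forall>j<n0. mr_elem M (x j)) \<and> (\<Sum>j<n0. mr_aug (x j) * c j) = z) \<and>
      (\<forall>x. (\<forall>j<n0. mr_elem M (x j)) \<longrightarrow>
          ((\<Sum>j<n0. mr_aug (x j) * c j) = 0 \<longleftrightarrow>
           (\<exists>y. (\<forall>i<n1. mr_elem M (y i)) \<and>
                (\<forall>j<n0. x j = (\<lambda>g. \<Sum>i<n1. mr_mult G (y i) (D i j) g))))))"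

text \<open>[chi] \<in> Sigma^1(G, Z): Z is of type FP_1 over Z G_chi, G_chi = {g. chi g \<ge> 0}.
  (This only depends on chi up to positive scaling.)\<close>
definition in_Sigma1 :: "('g, 'b) monoid_scheme \<Rightarrow> ('g \<Rightarrow> real) \<Rightarrow> bool" where
  "in_Sigma1 G \<chi> \<longleftrightarrow> FP1_over G {g \<in> carrier G. \<chi> g \<ge> 0}"

definition live_vertex :: "'v set \<Rightarrow> ('v \<Rightarrow> 'v \<Rightarrow> bool) \<Rightarrow> ('v \<Rightarrow> 'v \<Rightarrow> nat) \<Rightarrow> (('v \<times> bool) list set \<Rightarrow> real) \<Rightarrow> 'v \<Rightarrow> bool" where
  "live_vertex V E lab \<chi> v \<longleftrightarrow> v \<in> V \<and> \<chi> (artin_gen E lab v) \<noteq> 0"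

definition dead_edge :: "('v \<Rightarrow> 'v \<Rightarrow> bool) \<Rightarrow> ('v \<Rightarrow> 'v \<Rightarrow> nat) \<Rightarrow> (('v \<times> bool) list set \<Rightarrow> real) \<Rightarrow> 'v \<Rightarrow> 'v \<Rightarrow> bool" where
  "dead_edge E lab \<chi> u v \<longleftrightarrow> E u v \<and> even (lab u v) \<and> lab u v > 2 \<and>
     \<chi> (artin_gen E lab u) + \<chi> (artin_gen E lab v) = 0"

definition live_edge :: "'v set \<Rightarrow> ('v \<Rightarrow> 'v \<Rightarrow> bool) \<Rightarrow> ('v \<Rightarrow> 'v \<Rightarrow> nat) \<Rightarrow> (('v \<times> bool) list set \<Rightarrow> real) \<Rightarrow> 'v \<Rightarrow> 'v \<Rightarrow> bool" where
  "live_edge V E lab \<chi> u v \<longleftrightarrow> E u v \<and> live_vertex V E lab \<chi> u \<and> live_vertex V E lab \<chi> v \<and>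
     \<not> dead_edge E lab \<chi> u v"

definition liv_connected :: "'v set \<Rightarrow> ('v \<Rightarrow> 'v \<Rightarrow> bool) \<Rightarrow> ('v \<Rightarrow> 'v \<Rightarrow> nat) \<Rightarrow> (('v \<times> bool) list set \<Rightarrow> real) \<Rightarrow> bool" where
  "liv_connected V E lab \<chi> \<longleftrightarrow> (\<exists>v. live_vertex V E lab \<chi> v) \<and>
     (\<forall>u v. live_vertex V E lab \<chi> u \<and> live_vertex V E lab \<chi> v \<longrightarrow> (live_edge V E lab \<chi>)\<^sup>*\<^sup>* u v)"

definition liv_dominant :: "'v set \<Rightarrow> ('v \<Rightarrow> 'v \<Rightarrow> bool) \<Rightarrow> ('v \<Rightarrow> 'v \<Rightarrow> nat) \<Rightarrow> (('v \<times> bool) list set \<Rightarrow> real) \<Rightarrow> bool" where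
  "liv_dominant V E lab \<chi> \<longleftrightarrow>
     (\<forall>v\<in>V. \<not> live_vertex V E lab \<chi> v \<longrightarrow> (\<exists>u. live_vertex V E lab \<chi> u \<and> E v u))"

end

theory Submission
  imports Defs "HOL-Algebra.Generated_Groups"
begin

text \<open>
  Being of type FP_1 over the monoid ring of \<open>M = G\<^sub>\<chi>\<close> means that the Cayley graph of \<open>M\<close> with
  respect to some finite subset of \<open>M\<close> is connected.

  If the living subgraph is connected and dominant, the living generators together with the squared
  Garside elements of the dihedral subgroups on which \<open>\<chi>\<close> does not vanish form a connected
  commuting graph, and every generator commutes with one of them. Commutation squares far out then
  connect everything inside \<open>M\<close>.

  Conversely, let \<open>G\<close> act on a trivial bundle over the real line, covering the translations by
  \<open>\<chi>\<close>, such that every element preserves the zero section far to the left. Connectedness makes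
  "far to the left" uniform over \<open>M\<close>; conjugating by powers of an element that preserves the whole
  zero section shows that the kernel of \<open>\<chi>\<close> fixes the zero section. If the living subgraph is
  disconnected, a violating action on a complex line bundle is obtained by conjugating the
  generators of one component by a gauge transformation of order \<open>p\<close>; the dead edges are respected
  because \<open>p\<close> divides half their labels. If a vertex has only dead neighbours, take instead the
  reflection representation of the Coxeter group as fibre and conjugate only this vertex, by the
  translation by its fundamental weight over \<open>0\<close>. (The abelian coefficients of the first case do
  not suffice here when dead vertices are joined by edges with odd labels.)
\<close>

section \<open>The FP_1 condition and Cayley graphs\<close>

lemma mr_mult_eq_sum:
  assumes A: "finite A" "{x. f x \<noteq> 0} \<subseteq> A" and B: "finite B" "{x. h x \<noteq> 0} \<subseteq> B"
  shows "mr_mult G f h g = (\<Sum>a\<in>A. \<Sum>b\<in>B. if a \<otimes>\<^bsub>G\<^esub> b = g then f a * h b else 0)"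
proof -
  have "mr_mult G f h g
      = (\<Sum>x\<in>A \<times> B. if fst x \<otimes>\<^bsub>G\<^esub> snd x = g then f (fst x) * h (snd x) else 0)"
    unfolding mr_mult_def
    by (rule sum.mono_neutral_cong_left) (use A B in \<open>auto split: if_splits\<close>)
  then show ?thesis
    by (simp add: sum.cartesian_product case_prod_unfold)
qed

text \<open>Sum over the fibres of the multiplication. With \<open>\<phi>\<close> the indicator of
  an invariant predicate this serves one direction of the FP_1 criterion, with
  \<open>\<phi> = 1\<close> the other.\<close>

lemma sum_mr_mult:
  assumes A: "finite A" "{x. f x \<noteq> 0} \<subseteq> A" and B: "finite B" "{x. h x \<noteq> 0} \<subseteq> B"
    and S: "finite S" "\<And>a b. a \<in> A \<Longrightarrow> b \<in> B \<Longrightarrow> a \<otimes>\<^bsub>G\<^esub> b \<in> S"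
  shows "(\<Sum>g\<in>S. \<phi> g * mr_mult G f h g) = (\<Sum>a\<in>A. \<Sum>b\<in>B. \<phi> (a \<otimes>\<^bsub>G\<^esub> b) * (f a * h b))"
proof -
  have "(\<Sum>g\<in>S. \<phi> g * mr_mult G f h g)
      = (\<Sum>g\<in>S. \<Sum>a\<in>A. \<Sum>b\<in>B. if a \<otimes>\<^bsub>G\<^esub> b = g then \<phi> g * (f a * h b) else 0)"
    by (simp add: mr_mult_eq_sum[OF A B] sum_distrib_left if_distrib cong: if_cong)
  also have "\<dots> = (\<Sum>a\<in>A. \<Sum>b\<in>B. \<Sum>g\<in>S. if a \<otimes>\<^bsub>G\<^esub> b = g then \<phi> g * (f a * h b) else 0)"
    by (subst sum.swap, rule sum.cong[OF refl], rule sum.swap)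
  also have "\<dots> = (\<Sum>a\<in>A. \<Sum>b\<in>B. \<phi> (a \<otimes>\<^bsub>G\<^esub> b) * (f a * h b))"
    by (intro sum.cong refl) (use S in \<open>simp add: sum.delta'\<close>)
  finally show ?thesis .
qed

lemma mr_aug_eq_sum:
  assumes "finite A" "{x. f x \<noteq> 0} \<subseteq> A"
  shows "mr_aug f = sum f A"
  unfolding mr_aug_def by (rule sum.mono_neutral_left) (use assms in auto)

lemma mr_elemI: "{x. f x \<noteq> 0} \<subseteq> A \<Longrightarrow> finite A \<Longrightarrow> A \<subseteq> M \<Longrightarrow> mr_elem M f"
  unfolding mr_elem_def by (blast intro: finite_subset)

text \<open>Connectedness of the Cayley graph of \<open>M\<close> with respect to \<open>F\<close>: an invariant predicate
  is constant on \<open>M\<close>.\<close>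
definition cayley_connected :: "('g, 'b) monoid_scheme \<Rightarrow> 'g set \<Rightarrow> 'g set \<Rightarrow> bool" where
  "cayley_connected G M F \<longleftrightarrow>
    (\<forall>P. (\<forall>a\<in>M. \<forall>f\<in>F. P (a \<otimes>\<^bsub>G\<^esub> f) \<longleftrightarrow> P a) \<longrightarrow> (\<forall>m\<in>M. P m \<longleftrightarrow> P \<one>\<^bsub>G\<^esub>))"

text \<open>The indicator \<open>\<phi>\<close> of an invariant predicate satisfies
  \<open>\<phi> (a f) = \<phi> a\<close>, so pairing it with \<open>y D\<close> sees only the
  augmentations of the entries of \<open>D\<close>. The rows of \<open>D\<close> lie in the kernel
  of F_0 \<rightarrow> Z, so these contributions cancel once weighted by \<open>c\<close>. Exactness
  applied to a lift of \<open>m - 1\<close> then forces \<open>\<phi> m = \<phi> 1\<close>.\<close>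

lemma FP1_over_imp_cayley_connected:
  fixes G (structure)
  assumes "monoid G" and M: "M \<subseteq> carrier G" "\<one> \<in> M" and FP: "FP1_over G M"
  obtains F where "finite F" "F \<subseteq> M" "cayley_connected G M F"
proof -
  interpret monoid G by fact
  obtain n0 n1 :: nat and D :: "nat \<Rightarrow> nat \<Rightarrow> 'a \<Rightarrow> int" and c :: "nat \<Rightarrow> int" where H:
    "(\<forall>i<n1. \<forall>j<n0. mr_elem M (D i j)) \<and>
      (\<forall>z::int. \<exists>x. (\<forall>j<n0. mr_elem M (x j)) \<and> (\<Sum>j<n0. mr_aug (x j) * c j) = z) \<and>
      (\<forall>x. (\<forall>j<n0. mr_elem M (x j)) \<longrightarrow>
          ((\<Sum>j<n0. mr_aug (x j) * c j) = 0 \<longleftrightarrow>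
           (\<exists>y. (\<forall>i<n1. mr_elem M (y i)) \<and>
                (\<forall>j<n0. x j = (\<lambda>g. \<Sum>i<n1. mr_mult G (y i) (D i j) g)))))"
    using FP unfolding FP1_over_def by (elim exE) (rule that)
  note D = H[THEN conjunct1, rule_format]
  note surj = H[THEN conjunct2, THEN conjunct1, rule_format]
  note ex = H[THEN conjunct2, THEN conjunct2, THEN spec, THEN mp]
  obtain x0 :: "nat \<Rightarrow> 'a \<Rightarrow> int" where x0: "(\<Sum>j<n0. mr_aug (x0 j) * c j) = 1"
    using surj[of 1] by blast
  define F where "F = (\<Union>i<n1. \<Union>j<n0. {x. D i j x \<noteq> 0})"
  have F: "finite F" "F \<subseteq> M" and DF: "\<And>i j. i < n1 \<Longrightarrow> j < n0 \<Longrightarrow> {x. D i j x \<noteq> 0} \<subseteq> F"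
    using D by (auto simp: F_def mr_elem_def)
  \<comment> \<open>Row \<open>i\<close> is the image of the \<open>i\<close>-th basis vector
    \<open>y\<close> of F_1, so exactness puts it into the kernel.\<close>
  have rows: "(\<Sum>j<n0. mr_aug (D i j) * c j) = 0" if i: "i < n1" for i
  proof -
    define y where "y = (\<lambda>k g. of_bool (k = i \<and> g = \<one>) :: int)"
    have supp: "{x. y k x \<noteq> 0} \<subseteq> {\<one>}" for k
      by (auto simp: y_def)
    have "mr_elem M (y k)" for k
      using M by (intro mr_elemI[OF supp]) auto
    moreover have "D i j = (\<lambda>g. \<Sum>k<n1. mr_mult G (y k) (D k j) g)" if j: "j < n0" for j
    proof
      fix g
      have "(\<Sum>k<n1. mr_mult G (y k) (D k j) g)
          = (\<Sum>k<n1. \<Sum>a\<in>{\<one>}. \<Sum>b\<in>F. if a \<otimes> b = g then y k a * D k j b else 0)"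
        by (intro sum.cong refl mr_mult_eq_sum) (use F DF j supp in auto)
      also have "\<dots> = (\<Sum>k<n1. if k = i then (\<Sum>b\<in>F. if b = g then D k j b else 0) else 0)"
      proof (intro sum.cong refl)
        fix k
        have "(\<Sum>b\<in>F. if \<one> \<otimes> b = g then y k \<one> * D k j b else 0)
            = (\<Sum>b\<in>F. if b = g then of_bool (k = i) * D k j b else 0)"
          using F M by (intro sum.cong refl) (auto simp: y_def)
        then show "(\<Sum>a\<in>{\<one>}. \<Sum>b\<in>F. if a \<otimes> b = g then y k a * D k j b else 0)
            = (if k = i then \<Sum>b\<in>F. if b = g then D k j b else 0 else 0)"
          by (cases "k = i") (simp_all cong: if_cong)
      qed
      also have "\<dots> = (if g \<in> F then D i j g else 0)"
        using i F(1) by simp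
      also have "\<dots> = D i j g"
        using DF[OF i j] by auto
      finally show "D i j g = (\<Sum>k<n1. mr_mult G (y k) (D k j) g)" ..
    qed
    ultimately have "\<exists>y. (\<forall>k<n1. mr_elem M (y k)) \<and>
        (\<forall>j<n0. D i j = (\<lambda>g. \<Sum>k<n1. mr_mult G (y k) (D k j) g))"
      by (intro exI[of _ y]) simp
    then show ?thesis
      using ex[of "D i"] D[OF i] by (elim iffD2[rotated]) simp
  qed
  have "P m \<longleftrightarrow> P \<one>" if P: "\<forall>a\<in>M. \<forall>f\<in>F. P (a \<otimes> f) \<longleftrightarrow> P a" and m: "m \<in> M" for P m
  proof -
    define \<phi> where "\<phi> = (\<lambda>g. of_bool (P g) :: int)"
    \<comment> \<open>Each coordinate is a multiple of \<open>m - 1\<close>, so \<open>x\<close>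
      lies in the kernel; the factors \<open>mr_aug (x0 j)\<close>, weighted by \<open>c\<close>,
      sum to 1, which recovers \<open>\<phi> m - \<phi> 1\<close> at the end.\<close>
    define x where "x = (\<lambda>j g. mr_aug (x0 j) * (of_bool (g = m) - of_bool (g = \<one>)))"
    have supp: "{g. x j g \<noteq> 0} \<subseteq> {m, \<one>}" for j
      by (auto simp: x_def)
    have "mr_elem M (x j)" for j
      using M m by (intro mr_elemI[OF supp]) auto
    moreover have "mr_aug (x j) = 0" for j
      by (subst mr_aug_eq_sum[OF _ supp]) (auto simp: x_def sum.insert_if)
    ultimately obtain y where y: "\<And>i. i < n1 \<Longrightarrow> mr_elem M (y i)"
      and xy: "\<And>j. j < n0 \<Longrightarrow> x j = (\<lambda>g. \<Sum>i<n1. mr_mult G (y i) (D i j) g)"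
      using ex[of x] by auto
    define Y where "Y = (\<Union>i<n1. {g. y i g \<noteq> 0})"
    have Y: "finite Y" "Y \<subseteq> M" and yY: "\<And>i. i < n1 \<Longrightarrow> {g. y i g \<noteq> 0} \<subseteq> Y"
      using y by (auto simp: Y_def mr_elem_def)
    define S where "S = {m, \<one>} \<union> (\<lambda>(a, b). a \<otimes> b) ` (Y \<times> F)"
    have S: "finite S" "\<And>a b. a \<in> Y \<Longrightarrow> b \<in> F \<Longrightarrow> a \<otimes> b \<in> S"
      using Y F by (auto simp: S_def)
    have col: "mr_aug (x0 j) * (\<phi> m - \<phi> \<one>) = (\<Sum>i<n1. \<Sum>a\<in>Y. \<phi> a * y i a * mr_aug (D i j))"
      if j: "j < n0" for j
    proof -
      have "(\<Sum>g\<in>S. \<phi> g * x j g) = (\<Sum>g\<in>{m, \<one>}. \<phi> g * x j g)"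
        by (rule sum.mono_neutral_right) (use S supp[of j] in \<open>auto simp: S_def\<close>)
      also have "\<dots> = mr_aug (x0 j) * (\<phi> m - \<phi> \<one>)"
        by (auto simp: x_def sum.insert_if algebra_simps)
      finally have "mr_aug (x0 j) * (\<phi> m - \<phi> \<one>) = (\<Sum>g\<in>S. \<phi> g * x j g)" ..
      also have "\<dots> = (\<Sum>i<n1. \<Sum>g\<in>S. \<phi> g * mr_mult G (y i) (D i j) g)"
        by (simp add: xy[OF j] sum_distrib_left) (rule sum.swap)
      also have "\<dots> = (\<Sum>i<n1. \<Sum>a\<in>Y. \<Sum>b\<in>F. \<phi> (a \<otimes> b) * (y i a * D i j b))"
        by (intro sum.cong refl sum_mr_mult) (use Y F S yY DF j in auto)
      also have "\<dots> = (\<Sum>i<n1. \<Sum>a\<in>Y. \<Sum>b\<in>F. \<phi> a * (y i a * D i j b))"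
        using P Y by (intro sum.cong refl) (auto simp: \<phi>_def)
      also have "\<dots> = (\<Sum>i<n1. \<Sum>a\<in>Y. \<phi> a * y i a * mr_aug (D i j))"
        using j by (intro sum.cong refl)
          (auto simp: mr_aug_eq_sum[OF F(1) DF] sum_distrib_left mult.assoc)
      finally show ?thesis .
    qed
    have "\<phi> m - \<phi> \<one> = (\<Sum>j<n0. mr_aug (x0 j) * c j) * (\<phi> m - \<phi> \<one>)"
      by (simp add: x0)
    also have "\<dots> = (\<Sum>j<n0. c j * (mr_aug (x0 j) * (\<phi> m - \<phi> \<one>)))"
      unfolding sum_distrib_right by (simp add: mult_ac)
    also have "\<dots> = (\<Sum>j<n0. c j * (\<Sum>i<n1. \<Sum>a\<in>Y. \<phi> a * y i a * mr_aug (D i j)))"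
      by (intro sum.cong refl) (simp add: col)
    also have "\<dots> = (\<Sum>j<n0. \<Sum>i<n1. (\<Sum>a\<in>Y. \<phi> a * y i a) * (mr_aug (D i j) * c j))"
      unfolding sum_distrib_right sum_distrib_left by (simp add: mult_ac)
    also have "\<dots> = (\<Sum>i<n1. (\<Sum>a\<in>Y. \<phi> a * y i a) * (\<Sum>j<n0. mr_aug (D i j) * c j))"
      by (subst sum.swap) (simp add: sum_distrib_left)
    also have "\<dots> = 0"
      by (simp add: rows)
    finally show ?thesis
      by (auto simp: \<phi>_def split: if_splits)
  qed
  then have "cayley_connected G M F"
    unfolding cayley_connected_def by blast
  then show ?thesis
    using F that by blast
qed

text \<open>Take F_0 = Z M with the augmentation, and F_1 free on \<open>F\<close> with the basis
  vector of \<open>f\<close> sent to \<open>f - 1\<close>. That \<open>m - 1\<close> lies in the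
  image is an invariant condition on \<open>m\<close>, so connectedness gives it on all of
  \<open>M\<close>, and these differences span the augmentation ideal.\<close>

lemma cayley_connected_imp_FP1_over:
  fixes G (structure)
  assumes "monoid G" and M: "M \<subseteq> carrier G" "\<one> \<in> M"
    and Mmult: "\<And>a b. a \<in> M \<Longrightarrow> b \<in> M \<Longrightarrow> a \<otimes>\<^bsub>G\<^esub> b \<in> M"
    and F: "finite F" "F \<subseteq> M" and conn: "cayley_connected G M F"
  shows "FP1_over G M"
proof -
  interpret monoid G by fact
  obtain fs where fs: "bij_betw fs {..<card F} F"
    using ex_bij_betw_nat_finite[OF F(1)] by (auto simp: atLeast0LessThan)
  define n where "n = card F"
  have fsF: "fs i \<in> F" if "i < n" for i
    using fs that by (auto simp: n_def bij_betw_def)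
  define \<delta> where "\<delta> = (\<lambda>m g :: 'a. of_bool (g = m) :: int)"
  define D where "D = (\<lambda>(i::nat) (j::nat) g. \<delta> (fs i) g - \<delta> \<one> g)"
  define B where "B = insert \<one> F"
  have B: "finite B" "B \<subseteq> M"
    using F M by (auto simp: B_def)
  have DB: "{g. D i j g \<noteq> 0} \<subseteq> B" if "i < n" for i j
    using fsF[OF that] by (auto simp: B_def D_def \<delta>_def)
  have Dsum: "(\<Sum>b\<in>B. D i j b) = 0" if "i < n" for i j
    using fsF[OF that] F(1) by (simp add: D_def \<delta>_def sum_subtractf B_def of_bool_def)
  define comb where "comb = (\<lambda>y g. \<Sum>i<n. mr_mult G (y i) (D i 0) g)"
  \<comment> \<open>\<open>J\<close> is membership in the left ideal generated by the
    \<open>f - 1\<close>; F_0 has rank one, so column 0 is the only column of the matrix.\<close>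
  define J where "J = (\<lambda>x. \<exists>y. (\<forall>i<n. mr_elem M (y i)) \<and> x = comb y)"
  have comb_eq: "comb y g = (\<Sum>i<n. \<Sum>a\<in>Y. \<Sum>b\<in>B. if a \<otimes> b = g then y i a * D i 0 b else 0)"
    if "finite Y" "\<And>i. i < n \<Longrightarrow> {g. y i g \<noteq> 0} \<subseteq> Y" for y g Y
    unfolding comb_def by (intro sum.cong refl mr_mult_eq_sum) (use that B(1) DB in auto)
  have J0: "J (\<lambda>g. 0)"
  proof -
    have "comb (\<lambda>i g. 0) = (\<lambda>g. 0)"
      by (auto simp: comb_def mr_mult_def)
    then show ?thesis
      unfolding J_def by (intro exI[of _ "\<lambda>i g. 0"]) (simp add: mr_elem_def)
  qed
  have Jadd: "J (\<lambda>g. x g + k * x' g)" if J: "J x" "J x'" for x x' and k :: int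
  proof -
    obtain y y' where y: "\<And>i. i < n \<Longrightarrow> mr_elem M (y i)" "x = comb y"
      and y': "\<And>i. i < n \<Longrightarrow> mr_elem M (y' i)" "x' = comb y'"
      using J unfolding J_def by blast
    define Y where "Y = (\<Union>i<n. {g. y i g \<noteq> 0} \<union> {g. y' i g \<noteq> 0})"
    have Y: "finite Y" "Y \<subseteq> M" and yY: "\<And>i. i < n \<Longrightarrow> {g. y i g \<noteq> 0} \<subseteq> Y"
      "\<And>i. i < n \<Longrightarrow> {g. y' i g \<noteq> 0} \<subseteq> Y"
      using y y' by (auto simp: Y_def mr_elem_def)
    define z where "z = (\<lambda>i g. y i g + k * y' i g)"
    have zY: "{g. z i g \<noteq> 0} \<subseteq> Y" if "i < n" for i
    proof
      fix g assume "g \<in> {g. z i g \<noteq> 0}"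
      then have "y i g \<noteq> 0 \<or> y' i g \<noteq> 0" by (auto simp: z_def)
      then show "g \<in> Y" using yY[OF that] by blast
    qed
    have "mr_elem M (z i)" if "i < n" for i
      using Y by (intro mr_elemI[OF zY[OF that]])
    moreover have "(\<lambda>g. x g + k * x' g) = comb z"
    proof
      fix g
      have eqs: "comb u g = (\<Sum>i<n. \<Sum>a\<in>Y. \<Sum>b\<in>B. if a \<otimes> b = g then u i a * D i 0 b else 0)"
        if "u \<in> {y, y', z}" for u
        by (rule comb_eq[OF Y(1)]) (use yY zY that in blast)
      show "x g + k * x' g = comb z g"
        unfolding y(2) y'(2) eqs[of y, simplified] eqs[of y', simplified] eqs[of z, simplified]
          sum_distrib_left sum.distrib[symmetric]
        by (intro sum.cong refl) (simp add: z_def algebra_simps)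
    qed
    ultimately show ?thesis
      unfolding J_def by blast
  qed
  have Jsum: "J (\<lambda>g. \<Sum>m\<in>A. k m * x m g)" if "finite A" "\<And>m. m \<in> A \<Longrightarrow> J (x m)"
    for A :: "'a set" and k x
    using that
  proof (induction A rule: finite_induct)
    case empty
    then show ?case using J0 by simp
  next
    case (insert a A)
    then show ?case
      using Jadd[of "\<lambda>g. \<Sum>m\<in>A. k m * x m g" "x a" "k a"] by (simp add: add.commute)
  qed
  have Jedge: "J (\<lambda>g. \<delta> (m \<otimes> f) g - \<delta> m g)" if m: "m \<in> M" and f: "f \<in> F" for m f
  proof -
    obtain k where k: "k < n" "fs k = f"
      using bij_betw_imp_surj_on[OF fs] f unfolding n_def by (metis imageE lessThan_iff)
    define y where "y = (\<lambda>i g. of_bool (i = k \<and> g = m) :: int)"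
    have supp: "{g. y i g \<noteq> 0} \<subseteq> {m}" for i
      by (auto simp: y_def)
    have "mr_elem M (y i)" for i
      using m by (intro mr_elemI[OF supp]) auto
    moreover have "comb y g = \<delta> (m \<otimes> f) g - \<delta> m g" for g
    proof -
      have "comb y g = (\<Sum>i<n. \<Sum>a\<in>{m}. \<Sum>b\<in>B. if a \<otimes> b = g then y i a * D i 0 b else 0)"
        by (rule comb_eq) (use supp in auto)
      also have "\<dots> = (\<Sum>i<n. if i = k then \<Sum>b\<in>B. if m \<otimes> b = g then D i 0 b else 0 else 0)"
        by (intro sum.cong refl) (auto simp: y_def intro!: sum.cong sum.neutral)
      also have "\<dots> = (\<Sum>b\<in>B. if m \<otimes> b = g then D k 0 b else 0)"
        using k by simp
      also have "\<dots> = (\<Sum>b\<in>B. if b = f then of_bool (m \<otimes> f = g) else 0)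
          - (\<Sum>b\<in>B. if b = \<one> then of_bool (m \<otimes> \<one> = g) else 0)"
        unfolding sum_subtractf[symmetric] using k by (intro sum.cong refl) (auto simp: D_def \<delta>_def)
      also have "\<dots> = \<delta> (m \<otimes> f) g - \<delta> m g"
        using B(1) f m M by (auto simp: \<delta>_def B_def)
      finally show ?thesis .
    qed
    ultimately show ?thesis
      unfolding J_def by (intro exI[of _ y]) auto
  qed
  have Jm: "J (\<lambda>g. \<delta> m g - \<delta> \<one> g)" if "m \<in> M" for m
  proof -
    have "J (\<lambda>g. \<delta> (a \<otimes> f) g - \<delta> \<one> g) \<longleftrightarrow> J (\<lambda>g. \<delta> a g - \<delta> \<one> g)"
      if "a \<in> M" "f \<in> F" for a f
      using Jadd[of "\<lambda>g. \<delta> (a \<otimes> f) g - \<delta> \<one> g" "\<lambda>g. \<delta> (a \<otimes> f) g - \<delta> a g" "-1"]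
        Jadd[of "\<lambda>g. \<delta> a g - \<delta> \<one> g" "\<lambda>g. \<delta> (a \<otimes> f) g - \<delta> a g" 1] Jedge[OF that]
      by (auto simp: algebra_simps)
    then have "J (\<lambda>g. \<delta> m g - \<delta> \<one> g) \<longleftrightarrow> J (\<lambda>g. \<delta> \<one> g - \<delta> \<one> g)"
      using conn \<open>m \<in> M\<close> unfolding cayley_connected_def
      by (elim allE[of _ "\<lambda>m. J (\<lambda>g. \<delta> m g - \<delta> \<one> g)"]) blast
    then show ?thesis
      using J0 by simp
  qed
  have main: "mr_aug x = 0 \<longleftrightarrow> J x" if x: "mr_elem M x" for x
  proof
    assume aug: "mr_aug x = 0"
    define A where "A = {g. x g \<noteq> 0}"
    have A: "finite A" "A \<subseteq> M" using x by (auto simp: A_def mr_elem_def)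
    have "J (\<lambda>g. \<Sum>m\<in>A. x m * (\<delta> m g - \<delta> \<one> g))"
      using Jsum[of A "\<lambda>m g. \<delta> m g - \<delta> \<one> g" x] Jm A by auto
    also have "(\<lambda>g. \<Sum>m\<in>A. x m * (\<delta> m g - \<delta> \<one> g)) = x"
    proof
      fix g
      have "(\<Sum>m\<in>A. x m * (\<delta> m g - \<delta> \<one> g)) = (\<Sum>m\<in>A. x m * \<delta> m g) - (\<Sum>m\<in>A. x m) * \<delta> \<one> g"
        by (simp add: algebra_simps sum_subtractf sum_distrib_right)
      also have "(\<Sum>m\<in>A. x m) = 0"
        using aug by (simp add: mr_aug_def A_def)
      also have "(\<Sum>m\<in>A. x m * \<delta> m g) = x g"
        using A(1) by (simp add: \<delta>_def of_bool_def if_distrib A_def cong: if_cong)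
      finally show "(\<Sum>m\<in>A. x m * (\<delta> m g - \<delta> \<one> g)) = x g" by simp
    qed
    finally show "J x" .
  next
    assume "J x"
    then obtain y where y: "\<And>i. i < n \<Longrightarrow> mr_elem M (y i)" "x = comb y"
      unfolding J_def by blast
    define Y where "Y = (\<Union>i<n. {g. y i g \<noteq> 0})"
    have Y: "finite Y" and yY: "\<And>i. i < n \<Longrightarrow> {g. y i g \<noteq> 0} \<subseteq> Y"
      using y by (auto simp: Y_def mr_elem_def)
    define S where "S = {g. x g \<noteq> 0} \<union> (\<lambda>(a, b). a \<otimes> b) ` (Y \<times> B)"
    have S: "finite S" "\<And>a b. a \<in> Y \<Longrightarrow> b \<in> B \<Longrightarrow> a \<otimes> b \<in> S"
      using Y B(1) x by (auto simp: S_def mr_elem_def)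
    have "mr_aug x = sum x S"
      by (rule mr_aug_eq_sum) (use S in \<open>auto simp: S_def\<close>)
    also have "\<dots> = (\<Sum>i<n. \<Sum>g\<in>S. 1 * mr_mult G (y i) (D i 0) g)"
      unfolding y(2) comb_def by (subst sum.swap) simp
    also have "\<dots> = (\<Sum>i<n. \<Sum>a\<in>Y. \<Sum>b\<in>B. 1 * (y i a * D i 0 b))"
      by (intro sum.cong refl sum_mr_mult) (use Y yY B(1) DB S in auto)
    also have "\<dots> = 0"
      by (simp add: sum_distrib_left[symmetric] Dsum)
    finally show "mr_aug x = 0" .
  qed
  have D_elem: "mr_elem M (D i j)" if "i < n" for i j
    using B by (intro mr_elemI[OF DB[OF that]])
  have "\<exists>x. mr_elem M (x (0::nat)) \<and> mr_aug (x 0) = z" for z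
  proof (intro exI conjI)
    have supp: "{g. z * \<delta> \<one> g \<noteq> 0} \<subseteq> {\<one>}" by (auto simp: \<delta>_def)
    then show "mr_elem M ((\<lambda>_ g. z * \<delta> \<one> g) (0::nat))"
      using M mr_elemI[OF supp, of M] by auto
    show "mr_aug ((\<lambda>_ g. z * \<delta> \<one> g) (0::nat)) = z"
      using mr_aug_eq_sum[OF _ supp] by (simp add: \<delta>_def)
  qed
  moreover have "mr_aug x = 0 \<longleftrightarrow> (\<exists>y. (\<forall>i<n. mr_elem M (y i)) \<and>
      x = (\<lambda>g. \<Sum>i<n. mr_mult G (y i) (D i 0) g))" if "mr_elem M x" for x
    using main[OF that] by (simp add: J_def comb_def)
  ultimately show ?thesis
    unfolding FP1_over_def using D_elem
    by (intro exI[of _ "1::nat"] exI[of _ n] exI[of _ D] exI[of _ "\<lambda>_. 1::int"]) simp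
qed

section \<open>Commuting graphs\<close>

lemma character_mult:
  "character G \<chi> \<Longrightarrow> x \<in> carrier G \<Longrightarrow> y \<in> carrier G \<Longrightarrow> \<chi> (x \<otimes>\<^bsub>G\<^esub> y) = \<chi> x + \<chi> y"
  by (simp add: character_def)

lemma character_one:
  assumes "monoid G" "character G \<chi>"
  shows "\<chi> \<one>\<^bsub>G\<^esub> = 0"
  using character_mult[OF assms(2), of "\<one>\<^bsub>G\<^esub>" "\<one>\<^bsub>G\<^esub>"] assms(1) by (simp add: monoid.r_one)

lemma character_inv:
  assumes "group G" "character G \<chi>" "x \<in> carrier G"
  shows "\<chi> (inv\<^bsub>G\<^esub> x) = - \<chi> x"
  using character_mult[OF assms(2,3), of "inv\<^bsub>G\<^esub> x"] character_one[OF _ assms(2)] assms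
  by (simp add: group.r_inv group.inv_closed group.is_monoid)

lemma character_pow:
  assumes "monoid G" "character G \<chi>" "x \<in> carrier G"
  shows "\<chi> (x [^]\<^bsub>G\<^esub> (n::nat)) = real n * \<chi> x"
proof (induction n)
  case 0
  then show ?case using character_one[OF assms(1,2)] by simp
next
  case (Suc n)
  then show ?case
    using assms by (simp add: character_mult monoid.nat_pow_closed distrib_right)
qed

lemma in_Sigma1_imp_cayley_connected:
  assumes "group G" "character G \<chi>" "in_Sigma1 G \<chi>"
  obtains F where "finite F" "F \<subseteq> {g \<in> carrier G. \<chi> g \<ge> 0}"
    "cayley_connected G {g \<in> carrier G. \<chi> g \<ge> 0} F"
proof (rule FP1_over_imp_cayley_connected)
  interpret group G by fact
  show "monoid G" by (rule is_monoid)
  show "\<one>\<^bsub>G\<^esub> \<in> {g \<in> carrier G. \<chi> g \<ge> 0}"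
    using character_one[OF is_monoid assms(2)] by simp
  show "FP1_over G {g \<in> carrier G. \<chi> g \<ge> 0}"
    using assms(3) by (simp add: in_Sigma1_def)
qed (use that in auto)

lemma cayley_connected_imp_in_Sigma1:
  assumes "group G" "character G \<chi>" "finite F" "F \<subseteq> {g \<in> carrier G. \<chi> g \<ge> 0}"
    "cayley_connected G {g \<in> carrier G. \<chi> g \<ge> 0} F"
  shows "in_Sigma1 G \<chi>"
proof -
  interpret group G by fact
  show ?thesis
    unfolding in_Sigma1_def using assms character_one[OF is_monoid assms(2)]
    by (intro cayley_connected_imp_FP1_over[where F = F]) (auto simp: character_mult)
qed

section \<open>Paths in superlevel sets of the Cayley graph\<close>

definition half_step ::
  "('g, 'b) monoid_scheme \<Rightarrow> ('g \<Rightarrow> real) \<Rightarrow> 'g set \<Rightarrow> real \<Rightarrow> 'g \<Rightarrow> 'g \<Rightarrow> bool" where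
  "half_step G \<chi> F r g h \<longleftrightarrow> g \<in> carrier G \<and> r \<le> \<chi> g \<and> r \<le> \<chi> h \<and> (\<exists>f\<in>F. h = g \<otimes>\<^bsub>G\<^esub> f)"

text \<open>Two points are related when they lie in one component of the Cayley graph of the whole
  group restricted to height at least \<open>r\<close>. The threshold varies because left
  translation shifts it.\<close>

abbreviation half_conn ::
  "('g, 'b) monoid_scheme \<Rightarrow> ('g \<Rightarrow> real) \<Rightarrow> 'g set \<Rightarrow> real \<Rightarrow> 'g \<Rightarrow> 'g \<Rightarrow> bool" where
  "half_conn G \<chi> F r \<equiv> equivclp (half_step G \<chi> F r)"

lemma half_conn_mono:
  assumes "half_conn G \<chi> F r g h" "r' \<le> r"
  shows "half_conn G \<chi> F r' g h"
  using assms(1)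
proof (induction rule: equivclp_induct)
  case base
  then show ?case by simp
next
  case (step y z)
  then have "half_step G \<chi> F r' y z \<or> half_step G \<chi> F r' z y"
    using assms(2) by (auto simp: half_step_def)
  with step.IH show ?case
    by (rule equivclp_into_equivclp)
qed

text \<open>Edges are right multiplications, so left multiplication by \<open>k\<close> is an
  automorphism of the Cayley graph; it shifts all heights by \<open>\<chi> k\<close>.\<close>

lemma half_conn_translate:
  assumes "group G" "character G \<chi>" "F \<subseteq> carrier G" "k \<in> carrier G" "half_conn G \<chi> F r g h"
  shows "half_conn G \<chi> F (r + \<chi> k) (k \<otimes>\<^bsub>G\<^esub> g) (k \<otimes>\<^bsub>G\<^esub> h)"
  using assms(5)
proof (induction rule: equivclp_induct)
  case base
  then show ?case by simp
next
  case (step y z)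
  interpret group G by fact
  have *: "half_step G \<chi> F (r + \<chi> k) (k \<otimes>\<^bsub>G\<^esub> y) (k \<otimes>\<^bsub>G\<^esub> z)" if yz: "half_step G \<chi> F r y z" for y z
  proof -
    obtain f where f: "f \<in> F" "z = y \<otimes>\<^bsub>G\<^esub> f" "y \<in> carrier G" "r \<le> \<chi> y" "r \<le> \<chi> z"
      using yz by (auto simp: half_step_def)
    with assms show ?thesis
      by (auto simp: half_step_def character_mult subset_iff m_assoc[symmetric] intro!: bexI[of _ f])
  qed
  from step show ?case
    using * by (blast intro: equivclp_into_equivclp)
qed

lemma half_conn_pow:
  assumes "group G" "character G \<chi>" "F \<subseteq> carrier G" "f \<in> F" "0 \<le> \<chi> f" "g \<in> carrier G" "r \<le> \<chi> g"
  shows "half_conn G \<chi> F r g (g \<otimes>\<^bsub>G\<^esub> f [^]\<^bsub>G\<^esub> (n::nat))"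
proof (induction n)
  case 0
  interpret group G by fact
  show ?case using assms by simp
next
  case (Suc n)
  interpret group G by fact
  have f: "f \<in> carrier G" using assms by auto
  have "half_step G \<chi> F r (g \<otimes>\<^bsub>G\<^esub> f [^]\<^bsub>G\<^esub> n) (g \<otimes>\<^bsub>G\<^esub> f [^]\<^bsub>G\<^esub> Suc n)"
    using assms f unfolding half_step_def
    by (auto simp: m_assoc character_mult character_pow[OF is_monoid] intro!: bexI[of _ f] add_increasing2)
  then show ?case
    using Suc by (blast intro: equivclp_into_equivclp)
qed

lemma cayley_connectedI:
  assumes "group G" "character G \<chi>"
    and "\<And>m. m \<in> carrier G \<Longrightarrow> 0 \<le> \<chi> m \<Longrightarrow> half_conn G \<chi> F 0 \<one>\<^bsub>G\<^esub> m"
  shows "cayley_connected G {g \<in> carrier G. \<chi> g \<ge> 0} F"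
proof -
  let ?M = "{g \<in> carrier G. \<chi> g \<ge> 0}"
  have "P m \<longleftrightarrow> P \<one>\<^bsub>G\<^esub>" if P: "\<forall>a\<in>?M. \<forall>f\<in>F. P (a \<otimes>\<^bsub>G\<^esub> f) \<longleftrightarrow> P a" and m: "m \<in> ?M" for P m
  proof -
    have "half_conn G \<chi> F 0 \<one>\<^bsub>G\<^esub> m"
      using assms(3) m by simp
    then show ?thesis
    proof (induction rule: equivclp_induct)
      case base
      then show ?case by simp
    next
      case (step y z)
      then show ?case using P by (auto simp: half_step_def)
    qed
  qed
  then show ?thesis
    unfolding cayley_connected_def by blast
qed

text \<open>Far out, the rays of two commuting elements are joined by the commutation square.\<close>
lemma half_conn_commuting_rays:
  assumes "group G" "character G \<chi>" "F \<subseteq> carrier G" "t \<in> F" "t' \<in> F" "0 \<le> \<chi> t" "0 \<le> \<chi> t'"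
    and comm: "t \<otimes>\<^bsub>G\<^esub> t' = t' \<otimes>\<^bsub>G\<^esub> t" and r: "r \<le> real n * \<chi> t" "r \<le> real n' * \<chi> t'"
  shows "half_conn G \<chi> F r (t [^]\<^bsub>G\<^esub> (n::nat)) (t' [^]\<^bsub>G\<^esub> (n'::nat))"
proof -
  interpret group G by fact
  have t: "t \<in> carrier G" "t' \<in> carrier G" using assms by auto
  have "half_conn G \<chi> F r (t [^]\<^bsub>G\<^esub> n) (t [^]\<^bsub>G\<^esub> n \<otimes>\<^bsub>G\<^esub> t' [^]\<^bsub>G\<^esub> n')"
    using assms t by (intro half_conn_pow) (auto simp: character_pow[OF is_monoid])
  also have "t [^]\<^bsub>G\<^esub> n \<otimes>\<^bsub>G\<^esub> t' [^]\<^bsub>G\<^esub> n' = t' [^]\<^bsub>G\<^esub> n' \<otimes>\<^bsub>G\<^esub> t [^]\<^bsub>G\<^esub> n"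
    using t comm by (metis group_commutes_pow nat_pow_closed)
  also have "half_conn G \<chi> F r (t' [^]\<^bsub>G\<^esub> n' \<otimes>\<^bsub>G\<^esub> t [^]\<^bsub>G\<^esub> n) (t' [^]\<^bsub>G\<^esub> n')"
    using assms t by (intro equivclp_sym[OF half_conn_pow]) (auto simp: character_pow[OF is_monoid])
  finally show ?thesis .
qed

lemma ex_nat_mult_ge:
  fixes c r :: real
  assumes "0 < c"
  obtains n :: nat where "r \<le> real n * c"
proof -
  obtain n :: nat where "r / c \<le> real n"
    using real_arch_simple by blast
  with assms show ?thesis
    by (intro that[of n]) (simp add: field_simps)
qed

lemma (in group) commutes_inv:
  assumes "x \<otimes> y = y \<otimes> x" "x \<in> carrier G" "y \<in> carrier G"
  shows "x \<otimes> inv y = inv y \<otimes> x"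
  using assms by (metis inv_closed inv_solve_left inv_solve_right m_assoc m_closed)

text \<open>A path to \<open>m\<close> goes from 1 up the ray of \<open>t0\<close>, across to the
  translated ray starting at \<open>m\<close>, and down to \<open>m\<close>. The crossing may lose
  only a bounded height, uniformly in \<open>n\<close>; this is the property \<open>Q\<close>. It
  holds for generators since each commutes with a member of \<open>T\<close>, and passes to products
  by translation.\<close>

lemma commuting_graph_in_Sigma1_pos:
  assumes "group G" and \<chi>: "character G \<chi>"
    and S: "finite S" "S \<subseteq> carrier G" "carrier G \<subseteq> generate G S"
    and T: "finite T" "T \<subseteq> carrier G" "\<And>t. t \<in> T \<Longrightarrow> 0 < \<chi> t" "t0 \<in> T"
    and chain: "\<And>t. t \<in> T \<Longrightarrow> (\<lambda>x y. x \<in> T \<and> y \<in> T \<and> x \<otimes>\<^bsub>G\<^esub> y = y \<otimes>\<^bsub>G\<^esub> x)\<^sup>*\<^sup>* t0 t"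
    and dom: "\<And>s. s \<in> S \<Longrightarrow> \<exists>t\<in>T. s \<otimes>\<^bsub>G\<^esub> t = t \<otimes>\<^bsub>G\<^esub> s"
  shows "in_Sigma1 G \<chi>"
proof -
  interpret group G by fact
  \<comment> \<open>Of each generator and its inverse, those of nonnegative height are kept; so each
    generator labels an edge in at least one direction.\<close>
  define F where "F = T \<union> {s \<in> S \<union> m_inv G ` S. 0 \<le> \<chi> s}"
  have F: "finite F" "F \<subseteq> {g \<in> carrier G. \<chi> g \<ge> 0}"
    using S T by (auto simp: F_def subset_iff less_imp_le)
  then have FG: "F \<subseteq> carrier G" by auto
  have TF: "T \<subseteq> F" by (auto simp: F_def)
  have TG: "t \<in> carrier G" if "t \<in> T" for t using T that by auto
  note cpow = character_pow[OF is_monoid \<chi>]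
  let ?conn = "half_conn G \<chi> F"
  have rays: "?conn r (t0 [^]\<^bsub>G\<^esub> (n::nat)) (t [^]\<^bsub>G\<^esub> (n'::nat))"
    if t: "t \<in> T" and r: "r \<le> real n * \<chi> t0" "r \<le> real n' * \<chi> t" for t r n n'
    using chain[OF t] r(2)
  proof (induction arbitrary: n' rule: rtranclp_induct)
    case base
    then show ?case
      using half_conn_commuting_rays[OF is_group \<chi> FG, of t0 t0] T TF r(1) by (auto simp: less_imp_le)
  next
    case (step y z)
    \<comment> \<open>The exponent lifts the intermediate ray above level \<open>r\<close>, as the
      commutation square requires.\<close>
    obtain k :: nat where k: "r \<le> real k * \<chi> y"
      using ex_nat_mult_ge T(3) step(2) by blast
    have "?conn r (y [^]\<^bsub>G\<^esub> k) (z [^]\<^bsub>G\<^esub> n')"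
      using half_conn_commuting_rays[OF is_group \<chi> FG, of y z] step(2,4) T(3) TF k
      by (auto simp: less_imp_le subset_iff)
    with step(3)[OF k] show ?case
      by (rule equivclp_trans)
  qed
  define Q where "Q = (\<lambda>g. \<exists>K. \<forall>n::nat. ?conn (real n * \<chi> t0 - K) (t0 [^]\<^bsub>G\<^esub> n) (g \<otimes>\<^bsub>G\<^esub> t0 [^]\<^bsub>G\<^esub> n))"
  have Q_gen: "Q s" if s: "s \<in> S \<union> m_inv G ` S" for s
    unfolding Q_def
  proof (intro exI allI)
    fix n :: nat
    have sG: "s \<in> carrier G" using s S by auto
    obtain t where t: "t \<in> T" and st: "s \<otimes>\<^bsub>G\<^esub> t = t \<otimes>\<^bsub>G\<^esub> s"
    proof -
      obtain s' t where s': "s' \<in> S" "s = s' \<or> s = inv\<^bsub>G\<^esub> s'" "t \<in> T" "s' \<otimes>\<^bsub>G\<^esub> t = t \<otimes>\<^bsub>G\<^esub> s'"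
        using s dom by blast
      moreover from this have "inv\<^bsub>G\<^esub> s' \<otimes>\<^bsub>G\<^esub> t = t \<otimes>\<^bsub>G\<^esub> inv\<^bsub>G\<^esub> s'"
        using S TG commutes_inv[of t s'] by auto
      ultimately show ?thesis using that by blast
    qed
    obtain k :: nat where k: "real n * \<chi> t0 \<le> real k * \<chi> t"
      using ex_nat_mult_ge T(3)[OF t] by blast
    \<comment> \<open>The route is \<open>t0^n\<close>, \<open>t^k\<close>,
      \<open>t^k s = s t^k\<close>, \<open>s t0^n\<close>. Its last leg is translated by
      \<open>s\<close>; the absolute value covers the loss for either sign of
      \<open>\<chi> s\<close>.\<close>
    let ?r = "real n * \<chi> t0 - \<bar>\<chi> s\<bar>"
    have tk: "t [^]\<^bsub>G\<^esub> k \<in> carrier G" "t0 [^]\<^bsub>G\<^esub> n \<in> carrier G" using TG t T(4) by auto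
    have 1: "?conn ?r (t0 [^]\<^bsub>G\<^esub> n) (t [^]\<^bsub>G\<^esub> k)"
      using k by (intro rays t) auto
    have "?conn (real n * \<chi> t0 + \<chi> s) (s \<otimes>\<^bsub>G\<^esub> t0 [^]\<^bsub>G\<^esub> n) (s \<otimes>\<^bsub>G\<^esub> t [^]\<^bsub>G\<^esub> k)"
      using k by (intro half_conn_translate[OF is_group \<chi> FG sG] rays t) auto
    then have "?conn ?r (s \<otimes>\<^bsub>G\<^esub> t0 [^]\<^bsub>G\<^esub> n) (s \<otimes>\<^bsub>G\<^esub> t [^]\<^bsub>G\<^esub> k)"
      by (rule half_conn_mono) simp
    then have 2: "?conn ?r (s \<otimes>\<^bsub>G\<^esub> t [^]\<^bsub>G\<^esub> k) (s \<otimes>\<^bsub>G\<^esub> t0 [^]\<^bsub>G\<^esub> n)"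
      by (rule equivclp_sym)
    have 3: "s \<otimes>\<^bsub>G\<^esub> t [^]\<^bsub>G\<^esub> k = t [^]\<^bsub>G\<^esub> k \<otimes>\<^bsub>G\<^esub> s"
      using group_commutes_pow[OF st[symmetric]] TG[OF t] sG by auto
    have lev: "?r \<le> \<chi> (t [^]\<^bsub>G\<^esub> k)" "?r \<le> \<chi> (t [^]\<^bsub>G\<^esub> k \<otimes>\<^bsub>G\<^esub> s)"
      using k TG[OF t] tk sG by (auto simp: character_mult[OF \<chi>] cpow)
    have "?conn ?r (t [^]\<^bsub>G\<^esub> k) (t [^]\<^bsub>G\<^esub> k \<otimes>\<^bsub>G\<^esub> s)"
    proof (cases "0 \<le> \<chi> s")
      case True
      then have "s \<in> F" using s by (auto simp: F_def)
      then have "half_step G \<chi> F ?r (t [^]\<^bsub>G\<^esub> k) (t [^]\<^bsub>G\<^esub> k \<otimes>\<^bsub>G\<^esub> s)"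
        using lev tk by (auto simp: half_step_def)
      then show ?thesis by blast
    next
      \<comment> \<open>Here the edge is traversed backwards, with label
        \<open>inv s\<close>.\<close>
      case False
      moreover have "inv\<^bsub>G\<^esub> s \<in> S \<union> m_inv G ` S"
        using s S by (auto simp: subset_iff)
      ultimately have "inv\<^bsub>G\<^esub> s \<in> F"
        using character_inv[OF is_group \<chi> sG] by (auto simp: F_def)
      moreover have "t [^]\<^bsub>G\<^esub> k \<otimes>\<^bsub>G\<^esub> s \<otimes>\<^bsub>G\<^esub> inv\<^bsub>G\<^esub> s = t [^]\<^bsub>G\<^esub> k"
        using tk sG by (simp add: m_assoc)
      ultimately have "half_step G \<chi> F ?r (t [^]\<^bsub>G\<^esub> k \<otimes>\<^bsub>G\<^esub> s) (t [^]\<^bsub>G\<^esub> k)"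
        using lev tk sG by (auto simp: half_step_def intro!: bexI[of _ "inv\<^bsub>G\<^esub> s"])
      then show ?thesis by blast
    qed
    with 1 2 show "?conn ?r (t0 [^]\<^bsub>G\<^esub> n) (s \<otimes>\<^bsub>G\<^esub> t0 [^]\<^bsub>G\<^esub> n)"
      unfolding 3 by (blast intro: equivclp_trans)
  qed
  have Q_mult: "Q (g \<otimes>\<^bsub>G\<^esub> h)" if g: "g \<in> carrier G" "Q g" and h: "h \<in> carrier G" "Q h" for g h
  proof -
    obtain K K' where K: "\<And>n::nat. ?conn (real n * \<chi> t0 - K) (t0 [^]\<^bsub>G\<^esub> n) (g \<otimes>\<^bsub>G\<^esub> t0 [^]\<^bsub>G\<^esub> n)"
      and K': "\<And>n::nat. ?conn (real n * \<chi> t0 - K') (t0 [^]\<^bsub>G\<^esub> n) (h \<otimes>\<^bsub>G\<^esub> t0 [^]\<^bsub>G\<^esub> n)"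
      using g h unfolding Q_def by blast
    \<comment> \<open>Translating the path for \<open>h\<close> by \<open>g\<close> changes its loss
      from \<open>K'\<close> to \<open>K' - \<chi> g\<close>.\<close>
    define L where "L = max K (K' - \<chi> g)"
    have "?conn (real n * \<chi> t0 - L) (t0 [^]\<^bsub>G\<^esub> n) (g \<otimes>\<^bsub>G\<^esub> h \<otimes>\<^bsub>G\<^esub> t0 [^]\<^bsub>G\<^esub> n)" for n :: nat
    proof -
      have "?conn (real n * \<chi> t0 - L) (t0 [^]\<^bsub>G\<^esub> n) (g \<otimes>\<^bsub>G\<^esub> t0 [^]\<^bsub>G\<^esub> n)"
        by (rule half_conn_mono[OF K]) (simp add: L_def)
      also have "?conn (real n * \<chi> t0 - L) (g \<otimes>\<^bsub>G\<^esub> t0 [^]\<^bsub>G\<^esub> n) (g \<otimes>\<^bsub>G\<^esub> (h \<otimes>\<^bsub>G\<^esub> t0 [^]\<^bsub>G\<^esub> n))"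
        by (rule half_conn_mono[OF half_conn_translate[OF is_group \<chi> FG g(1) K']]) (simp add: L_def)
      finally show ?thesis
        using g h TG[OF T(4)] by (simp add: m_assoc)
    qed
    then show ?thesis unfolding Q_def by blast
  qed
  have Q_all: "Q g" if g: "g \<in> carrier G" for g
  proof -
    have "g \<in> generate G S" using g S by auto
    then show ?thesis
    proof (induction rule: generate.induct)
      case one
      have "?conn (real n * \<chi> t0 - 0) (t0 [^]\<^bsub>G\<^esub> n) (\<one>\<^bsub>G\<^esub> \<otimes>\<^bsub>G\<^esub> t0 [^]\<^bsub>G\<^esub> n)" for n :: nat
        using TG[OF T(4)] by simp
      then show ?case unfolding Q_def by blast
    next
      case (eng h1 h2)
      then show ?case
        using Q_mult generate_in_carrier[OF S(2)] by blast
    qed (use Q_gen in auto)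
  qed
  have "?conn 0 \<one>\<^bsub>G\<^esub> m" if m: "m \<in> carrier G" "0 \<le> \<chi> m" for m
  proof -
    obtain K where K: "\<And>n::nat. ?conn (real n * \<chi> t0 - K) (t0 [^]\<^bsub>G\<^esub> n) (m \<otimes>\<^bsub>G\<^esub> t0 [^]\<^bsub>G\<^esub> n)"
      using Q_all[OF m(1)] unfolding Q_def by blast
    obtain n :: nat where n: "K \<le> real n * \<chi> t0"
      using ex_nat_mult_ge T(3)[OF T(4)] by blast
    have up: "?conn 0 g (g \<otimes>\<^bsub>G\<^esub> t0 [^]\<^bsub>G\<^esub> n)" if "g \<in> carrier G" "0 \<le> \<chi> g" for g
      using that T(3,4) TF by (intro half_conn_pow[OF is_group \<chi> FG]) (auto simp: less_imp_le)
    have "?conn 0 \<one>\<^bsub>G\<^esub> (t0 [^]\<^bsub>G\<^esub> n)"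
      using up[of "\<one>\<^bsub>G\<^esub>"] character_one[OF is_monoid \<chi>] TG[OF T(4)] by simp
    also have "?conn 0 (t0 [^]\<^bsub>G\<^esub> n) (m \<otimes>\<^bsub>G\<^esub> t0 [^]\<^bsub>G\<^esub> n)"
      by (rule half_conn_mono[OF K]) (use n in simp)
    also have "?conn 0 (m \<otimes>\<^bsub>G\<^esub> t0 [^]\<^bsub>G\<^esub> n) m"
      using up[OF m] by (rule equivclp_sym)
    finally show ?thesis .
  qed
  then show ?thesis
    by (intro cayley_connected_imp_in_Sigma1[OF is_group \<chi> F] cayley_connectedI[OF is_group \<chi>])
qed

text \<open>Replacing members of negative height by their inverses preserves commutation, so the
  positive case applies.\<close>

lemma commuting_graph_in_Sigma1:
  assumes "group G" and \<chi>: "character G \<chi>"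
    and S: "finite S" "S \<subseteq> carrier G" "carrier G \<subseteq> generate G S"
    and T: "finite T" "T \<subseteq> carrier G" "\<And>t. t \<in> T \<Longrightarrow> \<chi> t \<noteq> 0" "t0 \<in> T"
    and chain: "\<And>t. t \<in> T \<Longrightarrow> (\<lambda>x y. x \<in> T \<and> y \<in> T \<and> x \<otimes>\<^bsub>G\<^esub> y = y \<otimes>\<^bsub>G\<^esub> x)\<^sup>*\<^sup>* t0 t"
    and dom: "\<And>s. s \<in> S \<Longrightarrow> \<exists>t\<in>T. s \<otimes>\<^bsub>G\<^esub> t = t \<otimes>\<^bsub>G\<^esub> s"
  shows "in_Sigma1 G \<chi>"
proof -
  interpret group G by fact
  define pos where "pos = (\<lambda>t. if 0 < \<chi> t then t else inv\<^bsub>G\<^esub> t)"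
  have TG: "t \<in> carrier G" if "t \<in> T" for t using T that by auto
  have pos_comm: "x \<otimes>\<^bsub>G\<^esub> pos y = pos y \<otimes>\<^bsub>G\<^esub> x"
    if "x \<otimes>\<^bsub>G\<^esub> y = y \<otimes>\<^bsub>G\<^esub> x" "x \<in> carrier G" "y \<in> carrier G" for x y
    using that commutes_inv by (simp add: pos_def)
  have posG: "pos y \<in> carrier G" if "y \<in> carrier G" for y
    using that by (simp add: pos_def)
  show ?thesis
  proof (rule commuting_graph_in_Sigma1_pos[OF is_group \<chi> S])
    show "finite (pos ` T)" "pos ` T \<subseteq> carrier G" "pos t0 \<in> pos ` T"
      using T posG by auto
    show "0 < \<chi> t" if "t \<in> pos ` T" for t
      using that T(3) TG character_inv[OF is_group \<chi>] by (force simp: pos_def)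
    show "\<exists>t\<in>pos ` T. s \<otimes>\<^bsub>G\<^esub> t = t \<otimes>\<^bsub>G\<^esub> s" if "s \<in> S" for s
      using dom[OF that] pos_comm S TG that by blast
    show "(\<lambda>x y. x \<in> pos ` T \<and> y \<in> pos ` T \<and> x \<otimes>\<^bsub>G\<^esub> y = y \<otimes>\<^bsub>G\<^esub> x)\<^sup>*\<^sup>* (pos t0) t"
      if t: "t \<in> pos ` T" for t
    proof -
      obtain u where u: "u \<in> T" "t = pos u" using t by blast
      show ?thesis
        unfolding u(2) using chain[OF u(1)]
      proof (induction rule: rtranclp_induct)
        case base
        show ?case by simp
      next
        case (step y z)
        then have "pos y \<otimes>\<^bsub>G\<^esub> pos z = pos z \<otimes>\<^bsub>G\<^esub> pos y"
          using pos_comm[of y z] pos_comm[of "pos z" y] posG TG by simp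
        with step show ?case
          by (intro rtranclp.rtrancl_into_rtrancl[OF step.IH]) auto
      qed
    qed
  qed
qed

section \<open>Artin groups\<close>

lemma artin_class_eq_iff:
  "artin_class E lab w = artin_class E lab w' \<longleftrightarrow> artin_rel E lab w w'"
  unfolding artin_class_def
  by (auto intro: ar_refl ar_sym ar_trans)

lemma artin_rel_append:
  assumes "artin_rel E lab x x'" "artin_rel E lab y y'"
  shows "artin_rel E lab (x @ y) (x' @ y')"
  using ar_cong[OF assms(1), of "[]" y] ar_cong[OF assms(2), of x' "[]"]
  by (auto intro: ar_trans)

lemma artin_rel_cancel_word:
  "artin_rel E lab (rev (map (\<lambda>(v, b). (v, \<not> b)) w) @ w) []"
proof (induction w)
  case Nil
  show ?case by (simp add: ar_refl)
next
  case (Cons l w)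
  obtain v b where l: "l = (v, b)" by (cases l)
  let ?i = "rev (map (\<lambda>(v, b). (v, \<not> b)) w)"
  have "artin_rel E lab (?i @ [(v, \<not> b), (v, \<not> \<not> b)] @ w) (?i @ [] @ w)"
    by (intro ar_cong ar_cancel)
  with Cons show ?case
    by (auto simp: l intro: ar_trans)
qed

lemma artin_mult:
  "artin_class E lab x \<otimes>\<^bsub>artin_group V E lab\<^esub> artin_class E lab y = artin_class E lab (x @ y)"
  by (auto simp: artin_group_def artin_class_def intro: ar_refl ar_trans ar_sym artin_rel_append)

lemma artin_one: "\<one>\<^bsub>artin_group V E lab\<^esub> = artin_class E lab []"
  by (simp add: artin_group_def)

lemma artin_carrier: "carrier (artin_group V E lab) = artin_class E lab ` lists (V \<times> UNIV)"
  by (simp add: artin_group_def)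

lemma artin_class_in_carrier:
  "w \<in> lists (V \<times> UNIV) \<Longrightarrow> artin_class E lab w \<in> carrier (artin_group V E lab)"
  by (simp add: artin_carrier)

lemma artin_gen_in_carrier: "v \<in> V \<Longrightarrow> artin_gen E lab v \<in> carrier (artin_group V E lab)"
  unfolding artin_gen_def by (rule artin_class_in_carrier) simp

lemma group_artin_group: "group (artin_group V E lab)"
proof (rule groupI)
  fix x assume "x \<in> carrier (artin_group V E lab)"
  then obtain w where w: "w \<in> lists (V \<times> UNIV)" "x = artin_class E lab w"
    by (auto simp: artin_carrier)
  then have "rev (map (\<lambda>(v, b). (v, \<not> b)) w) \<in> lists (V \<times> UNIV)"
    by (auto simp: in_lists_conv_set)
  then show "\<exists>y\<in>carrier (artin_group V E lab). y \<otimes>\<^bsub>artin_group V E lab\<^esub> x = \<one>\<^bsub>artin_group V E lab\<^esub>"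
    unfolding w(2) using artin_rel_cancel_word[of E lab w]
    by (intro bexI[OF _ artin_class_in_carrier]) (auto simp: artin_mult artin_one artin_class_eq_iff)
next
  fix x y assume "x \<in> carrier (artin_group V E lab)" "y \<in> carrier (artin_group V E lab)"
  then obtain w w' where "w \<in> lists (V \<times> UNIV)" "x = artin_class E lab w"
    "w' \<in> lists (V \<times> UNIV)" "y = artin_class E lab w'"
    by (auto simp: artin_carrier)
  then show "x \<otimes>\<^bsub>artin_group V E lab\<^esub> y \<in> carrier (artin_group V E lab)"
    by (simp only: artin_mult, intro artin_class_in_carrier) simp
qed (auto simp: artin_carrier artin_mult artin_one)

lemma inv_artin_gen:
  assumes "v \<in> V"
  shows "inv\<^bsub>artin_group V E lab\<^esub> (artin_gen E lab v) = artin_class E lab [(v, True)]"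
proof (rule group.inv_equality[OF group_artin_group])
  show "artin_class E lab [(v, True)] \<otimes>\<^bsub>artin_group V E lab\<^esub> artin_gen E lab v = \<one>\<^bsub>artin_group V E lab\<^esub>"
    using ar_cancel[of E lab v True] by (simp add: artin_gen_def artin_mult artin_one artin_class_eq_iff)
qed (use assms in \<open>auto simp: artin_gen_in_carrier artin_class_in_carrier\<close>)

lemma artin_group_generated:
  "carrier (artin_group V E lab) \<subseteq> generate (artin_group V E lab) (artin_gen E lab ` V)"
proof
  fix x assume "x \<in> carrier (artin_group V E lab)"
  then obtain w where w: "w \<in> lists (V \<times> UNIV)" "x = artin_class E lab w"
    by (auto simp: artin_carrier)
  show "x \<in> generate (artin_group V E lab) (artin_gen E lab ` V)"
    unfolding w(2) using w(1)
  proof (induction w)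
    case Nil
    show ?case by (metis generate.one artin_one)
  next
    case (Cons l w)
    obtain v b where l: "l = (v, b)" by (cases l)
    have v: "v \<in> V" using Cons l by simp
    have "artin_class E lab [l] \<in> generate (artin_group V E lab) (artin_gen E lab ` V)"
      using generate.inv[of "artin_gen E lab v" "artin_gen E lab ` V" "artin_group V E lab"]
        generate.incl[of "artin_gen E lab v" "artin_gen E lab ` V" "artin_group V E lab"] v
      by (cases b) (simp_all add: l inv_artin_gen artin_gen_def[symmetric])
    then have "artin_class E lab [l] \<otimes>\<^bsub>artin_group V E lab\<^esub> artin_class E lab w
        \<in> generate (artin_group V E lab) (artin_gen E lab ` V)"
      using Cons by (intro generate.eng) auto
    then show ?case by (simp add: artin_mult)
  qed
qed

section \<open>Heights of words, alternating words and Garside elements\<close>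

fun letter_weight :: "('v \<Rightarrow> real) \<Rightarrow> 'v \<times> bool \<Rightarrow> real" where
  "letter_weight c (v, b) = (if b then - c v else c v)"

definition word_weight :: "('v \<Rightarrow> real) \<Rightarrow> ('v \<times> bool) list \<Rightarrow> real" where
  "word_weight c w = sum_list (map (letter_weight c) w)"

lemma word_weight_simps [simp]:
  "word_weight c [] = 0" "word_weight c (l # w) = letter_weight c l + word_weight c w"
  "word_weight c (w @ w') = word_weight c w + word_weight c w'"
  by (simp_all add: word_weight_def)

lemma character_artin_class:
  assumes \<chi>: "character (artin_group V E lab) \<chi>" and w: "w \<in> lists (V \<times> UNIV)"
  shows "\<chi> (artin_class E lab w) = word_weight (\<lambda>v. \<chi> (artin_gen E lab v)) w"
  using w
proof (induction w)
  case Nil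
  show ?case
    using character_one[OF group.is_monoid[OF group_artin_group] \<chi>] by (simp add: artin_one)
next
  case (Cons l w)
  obtain v b where l: "l = (v, b)" by (cases l)
  have v: "v \<in> V" using Cons l by simp
  have "\<chi> (artin_class E lab [l]) = letter_weight (\<lambda>v. \<chi> (artin_gen E lab v)) l"
    using character_inv[OF group_artin_group \<chi> artin_gen_in_carrier[OF v]] v
    by (cases b) (simp_all add: l inv_artin_gen, simp add: artin_gen_def)
  moreover have "\<chi> (artin_class E lab [l] \<otimes>\<^bsub>artin_group V E lab\<^esub> artin_class E lab w)
      = \<chi> (artin_class E lab [l]) + \<chi> (artin_class E lab w)"
    using Cons by (intro character_mult[OF \<chi>] artin_class_in_carrier) auto
  ultimately show ?case
    using Cons by (simp add: artin_mult)
qed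

lemma alt_word_0 [simp]: "alt_word u v 0 = []"
  by (simp add: alt_word_def)

lemma alt_word_Suc: "alt_word u v (Suc n) = (u, False) # alt_word v u n"
proof -
  have "[0..<Suc n] = 0 # map Suc [0..<n]"
    by (simp add: upt_conv_Cons map_Suc_upt del: upt_Suc)
  then show ?thesis
    unfolding alt_word_def by (simp del: upt_Suc)
qed

lemma alt_word_snoc: "alt_word u v (Suc n) = alt_word u v n @ [(if even n then u else v, False)]"
  by (simp add: alt_word_def)

lemma alt_word_in_lists: "u \<in> V \<Longrightarrow> v \<in> V \<Longrightarrow> alt_word u v n \<in> lists (V \<times> UNIV)"
  by (auto simp: alt_word_def in_lists_conv_set)

lemma word_weight_alt_word:
  "word_weight c (alt_word u v n) = real ((n + 1) div 2) * c u + real (n div 2) * c v"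
proof (induction n arbitrary: u v)
  case (Suc n)
  have "(Suc n + 1) div 2 = Suc (n div 2)" by simp
  then show ?case
    by (simp add: alt_word_Suc Suc algebra_simps)
qed simp

text \<open>Write the Garside element as the alternating word starting in \<open>v\<close>. A
  leading \<open>u\<close> gives the alternating word of length \<open>lab u v + 1\<close>, whose
  last letter depends on the parity of the label.\<close>

lemma artin_gen_garside:
  assumes "E u v" "E v u" "lab u v = lab v u"
  shows "artin_gen E lab u \<otimes>\<^bsub>artin_group V E lab\<^esub> artin_class E lab (alt_word u v (lab u v))
    = artin_class E lab (alt_word u v (lab u v)) \<otimes>\<^bsub>artin_group V E lab\<^esub>
      artin_gen E lab (if even (lab u v) then u else v)"
proof -
  have "artin_class E lab (alt_word u v (lab u v)) = artin_class E lab (alt_word v u (lab u v))"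
    using ar_braid[of E u v lab] assms by (simp add: artin_class_eq_iff)
  then have "artin_gen E lab u \<otimes>\<^bsub>artin_group V E lab\<^esub> artin_class E lab (alt_word u v (lab u v))
      = artin_class E lab (alt_word u v (Suc (lab u v)))"
    by (simp only: artin_gen_def artin_mult alt_word_Suc) simp
  then show ?thesis
    by (simp only: artin_gen_def artin_mult alt_word_snoc)
qed

section \<open>Full twists on edges and the sufficient condition\<close>

locale artin_character =
  fixes V :: "'v set" and E :: "'v \<Rightarrow> 'v \<Rightarrow> bool" and lab :: "'v \<Rightarrow> 'v \<Rightarrow> nat"
    and \<chi> :: "('v \<times> bool) list set \<Rightarrow> real"
  assumes graph: "labelled_graph V E lab"
    and char: "character (artin_group V E lab) \<chi>"
begin

abbreviation "G \<equiv> artin_group V E lab"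
abbreviation "gen \<equiv> artin_gen E lab"
abbreviation "cls \<equiv> artin_class E lab"
abbreviation "ht \<equiv> \<lambda>v. \<chi> (artin_gen E lab v)"

sublocale group G
  by (rule group_artin_group)

lemma finite_V: "finite V"
  using graph by (simp add: labelled_graph_def)

lemma edgeD:
  assumes "E u v"
  shows "u \<in> V" "v \<in> V" "u \<noteq> v" "E v u" "lab u v = lab v u" "2 \<le> lab u v"
  using graph assms by (auto simp: labelled_graph_def)

text \<open>For an odd label the Garside element conjugates the two generators into each other, and
  characters are constant on conjugacy classes.\<close>

lemma odd_edge_ht:
  assumes e: "E u v" and "odd (lab u v)"
  shows "ht u = ht v"
proof -
  note D = edgeD[OF e]
  have d: "cls (alt_word u v (lab u v)) \<in> carrier G"
    using D by (intro artin_class_in_carrier alt_word_in_lists)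
  have "\<chi> (gen u \<otimes>\<^bsub>G\<^esub> cls (alt_word u v (lab u v))) = \<chi> (cls (alt_word u v (lab u v)) \<otimes>\<^bsub>G\<^esub> gen v)"
    using artin_gen_garside[of E u v lab V] e D assms(2) by simp
  then show ?thesis
    using d D by (simp add: character_mult[OF char] artin_gen_in_carrier)
qed

text \<open>The full twist. The square is taken because for an odd label the Garside element itself
  swaps the two generators.\<close>

definition garside_sq :: "'v \<Rightarrow> 'v \<Rightarrow> ('v \<times> bool) list set" where
  "garside_sq u v = cls (alt_word u v (lab u v)) \<otimes>\<^bsub>G\<^esub> cls (alt_word u v (lab u v))"

lemma garside_sq_in_carrier: "E u v \<Longrightarrow> garside_sq u v \<in> carrier G"
  unfolding garside_sq_def using edgeD
  by (intro m_closed artin_class_in_carrier alt_word_in_lists) auto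

lemma garside_sq_sym:
  assumes "E u v"
  shows "garside_sq v u = garside_sq u v"
proof -
  have "cls (alt_word u v (lab u v)) = cls (alt_word v u (lab u v))"
    using ar_braid[of E u v lab] assms by (simp add: artin_class_eq_iff)
  then show ?thesis
    using edgeD[OF assms] by (simp add: garside_sq_def)
qed

text \<open>Passing one Garside element turns \<open>u\<close> into \<open>w\<close>, and passing
  the second turns \<open>w\<close> back into \<open>u\<close>.\<close>

lemma garside_sq_commutes:
  assumes e: "E u v"
  shows "gen u \<otimes>\<^bsub>G\<^esub> garside_sq u v = garside_sq u v \<otimes>\<^bsub>G\<^esub> gen u"
proof -
  note D = edgeD[OF e]
  define d where "d = cls (alt_word u v (lab u v))"
  define w where "w = (if even (lab u v) then u else v)"
  have dG: "d \<in> carrier G"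
    unfolding d_def using D by (intro artin_class_in_carrier alt_word_in_lists)
  have dvu: "d = cls (alt_word v u (lab v u))"
    using ar_braid[of E u v lab] e D by (simp add: artin_class_eq_iff d_def)
  have wV: "w \<in> V" using D by (simp add: w_def)
  have 1: "gen u \<otimes>\<^bsub>G\<^esub> d = d \<otimes>\<^bsub>G\<^esub> gen w"
    unfolding d_def w_def using artin_gen_garside e D by metis
  have "gen v \<otimes>\<^bsub>G\<^esub> d = d \<otimes>\<^bsub>G\<^esub> gen (if even (lab v u) then v else u)"
    unfolding dvu using artin_gen_garside e D by metis
  with 1 have 2: "gen w \<otimes>\<^bsub>G\<^esub> d = d \<otimes>\<^bsub>G\<^esub> gen u"
    using D by (auto simp: w_def)
  have G: "gen u \<in> carrier G" "gen w \<in> carrier G"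
    using D wV by (auto intro: artin_gen_in_carrier)
  have "gen u \<otimes>\<^bsub>G\<^esub> (d \<otimes>\<^bsub>G\<^esub> d) = d \<otimes>\<^bsub>G\<^esub> (gen w \<otimes>\<^bsub>G\<^esub> d)"
    using 1 dG G by (metis m_assoc)
  also have "\<dots> = d \<otimes>\<^bsub>G\<^esub> d \<otimes>\<^bsub>G\<^esub> gen u"
    using 2 dG G by (simp add: m_assoc)
  finally show ?thesis
    by (simp add: garside_sq_def d_def)
qed

lemma garside_sq_commutes':
  assumes "E u v"
  shows "gen v \<otimes>\<^bsub>G\<^esub> garside_sq u v = garside_sq u v \<otimes>\<^bsub>G\<^esub> gen v"
  using garside_sq_commutes[OF edgeD(4)[OF assms]] garside_sq_sym[OF assms] by simp

text \<open>For an even label both generators occur equally often; for an odd one their heights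
  agree. Hence a twist has nonzero height exactly when the heights of the ends do not
  cancel.\<close>

lemma character_garside_sq:
  assumes e: "E u v"
  shows "\<chi> (garside_sq u v) = real (lab u v) * (ht u + ht v)"
proof -
  note D = edgeD[OF e]
  have "\<chi> (garside_sq u v) = 2 * word_weight ht (alt_word u v (lab u v))"
    using D by (simp add: garside_sq_def artin_mult character_artin_class[OF char] alt_word_in_lists)
  also have "\<dots> = real (lab u v) * (ht u + ht v)"
  proof (cases "even (lab u v)")
    case True
    then show ?thesis
      by (auto simp: word_weight_alt_word algebra_simps elim!: evenE)
  next
    case False
    then show ?thesis
      using odd_edge_ht[OF e] by (auto simp: word_weight_alt_word algebra_simps elim!: oddE)
  qed
  finally show ?thesis .
qed

lemma in_Sigma1_if_liv_connected_dominant: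
  assumes "liv_connected V E lab \<chi>" "liv_dominant V E lab \<chi>"
  shows "in_Sigma1 G \<chi>"
proof -
  let ?live = "live_vertex V E lab \<chi>"
  obtain a where a: "?live a"
    using assms(1) by (auto simp: liv_connected_def)
  \<comment> \<open>A twist commutes with both ends of its edge: it links live neighbours whose
    label exceeds 2, and it is the partner of a dead vertex with a live neighbour.\<close>
  define T where "T = gen ` {v. ?live v} \<union> {garside_sq u v |u v. E u v \<and> \<chi> (garside_sq u v) \<noteq> 0}"
  define R where "R = (\<lambda>x y. x \<in> T \<and> y \<in> T \<and> x \<otimes>\<^bsub>G\<^esub> y = y \<otimes>\<^bsub>G\<^esub> x)"
  have live: "v \<in> V" "ht v \<noteq> 0" if "?live v" for v
    using that by (auto simp: live_vertex_def)
  have T_live: "gen v \<in> T" if "?live v" for v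
    using that by (auto simp: T_def)
  have T_sq: "garside_sq u v \<in> T" if "E u v" "ht u + ht v \<noteq> 0" for u v
  proof -
    have "\<chi> (garside_sq u v) \<noteq> 0"
      using that edgeD(6)[OF that(1)] by (simp add: character_garside_sq)
    with that show ?thesis unfolding T_def by blast
  qed
  have R_sym: "R y x" if "R x y" for x y
    using that by (auto simp: R_def)
  have "T \<subseteq> gen ` V \<union> (\<Union>u\<in>V. garside_sq u ` V)"
  proof
    fix t assume "t \<in> T"
    then consider v where "?live v" "t = gen v" | u v where "E u v" "t = garside_sq u v"
      by (auto simp: T_def)
    then show "t \<in> gen ` V \<union> (\<Union>u\<in>V. garside_sq u ` V)"
    proof cases
      case 1
      then show ?thesis using live by simp
    next
      case 2
      then show ?thesis using edgeD(1,2)[OF 2(1)] by blast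
    qed
  qed
  then have T_fin: "finite T"
    using finite_V by (auto intro: finite_subset)
  have TG: "T \<subseteq> carrier G"
    using live by (auto simp: T_def garside_sq_in_carrier artin_gen_in_carrier)
  have live_chain: "R\<^sup>*\<^sup>* (gen a) (gen v)" if v: "?live v" for v
  proof -
    have "(live_edge V E lab \<chi>)\<^sup>*\<^sup>* a v"
      using assms(1) a v by (auto simp: liv_connected_def)
    then show ?thesis
    proof (induction rule: rtranclp_induct)
      case base
      show ?case by simp
    next
      case (step x y)
      then have e: "E x y" "?live x" "?live y" "\<not> dead_edge E lab \<chi> x y"
        by (auto simp: live_edge_def)
      note D = edgeD[OF e(1)]
      show ?case
      proof (cases "lab x y = 2")
        \<comment> \<open>With label 2 the heights may cancel although the edge is not dead, but the
          generators commute directly.\<close>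
        case True
        then have "gen x \<otimes>\<^bsub>G\<^esub> gen y = gen y \<otimes>\<^bsub>G\<^esub> gen x"
          using ar_braid[of E x y lab, OF e(1)]
          by (simp add: artin_gen_def artin_mult artin_class_eq_iff numeral_2_eq_2 alt_word_Suc)
        then have "R (gen x) (gen y)"
          using T_live e by (auto simp: R_def)
        with step.IH show ?thesis by simp
      next
        case False
        \<comment> \<open>An even label above 2 with cancelling heights would make the edge dead; an
          odd label gives equal nonzero heights.\<close>
        have "ht x + ht y \<noteq> 0"
        proof (cases "even (lab x y)")
          case True
          then show ?thesis using e False D by (auto simp: dead_edge_def)
        next
          case False
          then show ?thesis using odd_edge_ht[OF e(1)] live[OF e(2)] by simp
        qed
        then have "R (gen x) (garside_sq x y)" "R (garside_sq x y) (gen y)"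
          using T_sq T_live e garside_sq_commutes[OF e(1)] garside_sq_commutes'[OF e(1)]
          by (auto simp: R_def)
        with step.IH show ?thesis
          by (meson rtranclp.rtrancl_into_rtrancl)
      qed
    qed
  qed
  have chain: "R\<^sup>*\<^sup>* (gen a) t" if t: "t \<in> T" for t
  proof (cases "t \<in> gen ` {v. ?live v}")
    case True
    then show ?thesis using live_chain by blast
  next
    case False
    with t obtain u v where uv: "t = garside_sq u v" "E u v" "\<chi> t \<noteq> 0"
      by (auto simp: T_def)
    \<comment> \<open>A twist of nonzero height has a live end, whose generator attaches it to the
      chain.\<close>
    then have "ht u \<noteq> 0 \<or> ht v \<noteq> 0"
      by (auto simp: character_garside_sq)
    then obtain w where w: "?live w" "w = u \<or> w = v"
      using edgeD[OF uv(2)] by (auto simp: live_vertex_def)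
    then have "R (gen w) t"
      using t T_live garside_sq_commutes[OF uv(2)] garside_sq_commutes'[OF uv(2)]
      by (auto simp: R_def uv(1))
    with live_chain[OF w(1)] show ?thesis by simp
  qed
  have dom: "\<exists>t\<in>T. gen v \<otimes>\<^bsub>G\<^esub> t = t \<otimes>\<^bsub>G\<^esub> gen v" if v: "v \<in> V" for v
  proof (cases "?live v")
    case True
    then show ?thesis using T_live by blast
  next
    case False
    then obtain u where u: "?live u" "E v u"
      using assms(2) v by (auto simp: liv_dominant_def)
    \<comment> \<open>As \<open>v\<close> is dead, the heights on the edge to the live vertex
      \<open>u\<close> cannot cancel.\<close>
    moreover have "ht v = 0" using False v by (simp add: live_vertex_def)
    ultimately show ?thesis
      using T_sq[OF u(2)] live(2)[OF u(1)] garside_sq_commutes[OF u(2)] by auto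
  qed
  show ?thesis
  proof (rule commuting_graph_in_Sigma1[OF is_group char _ _ artin_group_generated T_fin TG])
    show "finite (gen ` V)" "gen ` V \<subseteq> carrier G"
      using finite_V by (auto simp: artin_gen_in_carrier)
    show "\<chi> t \<noteq> 0" if "t \<in> T" for t
      using that live by (auto simp: T_def)
    show "gen a \<in> T" using T_live[OF a] .
  qed (use chain dom in \<open>auto simp: R_def\<close>)
qed

end

section \<open>Actions on bundles over the real line\<close>

text \<open>The zero section is the set of points \<open>(r, z)\<close>.\<close>
locale artin_action = artin_character V E lab \<chi>
  for V :: "'v set" and E :: "'v \<Rightarrow> 'v \<Rightarrow> bool" and lab :: "'v \<Rightarrow> 'v \<Rightarrow> nat"
    and \<chi> :: "('v \<times> bool) list set \<Rightarrow> real" +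
  fixes act :: "'v \<times> bool \<Rightarrow> real \<times> 'a \<Rightarrow> real \<times> 'a" and z :: 'a
  assumes act_cancel: "act (v, b) (act (v, \<not> b) p) = p"
    and act_braid: "E u v \<Longrightarrow> foldr act (alt_word u v (lab u v)) = foldr act (alt_word v u (lab u v))"
    and act_low: "\<exists>B. \<forall>r<B. act l (r, z) = (r + letter_weight ht l, z)"
begin

lemma foldr_act_artin_rel: "artin_rel E lab w w' \<Longrightarrow> foldr act w = foldr act w'"
proof (induction rule: artin_rel.induct)
  case (ar_cong w w' a b)
  then show ?case by (intro ext) simp
next
  case (ar_cancel v b)
  show ?case by (intro ext) (simp add: act_cancel)
next
  case (ar_braid u v)
  then show ?case by (rule act_braid)
qed simp_all

text \<open>The chosen word may contain letters outside \<open>V\<close>; invariance under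
  \<open>artin_rel\<close> holds for all words, so any choice gives the same map.\<close>

definition gact :: "('v \<times> bool) list set \<Rightarrow> real \<times> 'a \<Rightarrow> real \<times> 'a" where
  "gact g = foldr act (SOME w. cls w = g)"

lemma gact_cls: "gact (cls w) = foldr act w"
proof -
  have "cls (SOME w'. cls w' = cls w) = cls w"
    by (rule someI) simp
  then show ?thesis
    unfolding gact_def by (intro foldr_act_artin_rel) (simp add: artin_class_eq_iff)
qed

lemma gact_mult:
  assumes "g \<in> carrier G" "h \<in> carrier G"
  shows "gact (g \<otimes>\<^bsub>G\<^esub> h) p = gact g (gact h p)"
  using assms by (auto simp: artin_carrier artin_mult gact_cls)

text \<open>The bound is on the end point \<open>r + \<chi> g\<close>, not on the start: in this
  form the same \<open>B\<close> survives products whose left factor has nonnegative height.\<close>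

definition low :: "real \<Rightarrow> ('v \<times> bool) list set \<Rightarrow> bool" where
  "low B g \<longleftrightarrow> (\<forall>r. r + \<chi> g < B \<longrightarrow> gact g (r, z) = (r + \<chi> g, z))"

lemma low_mono: "low B g \<Longrightarrow> B' \<le> B \<Longrightarrow> low B' g"
  by (auto simp: low_def)

lemma low_mult:
  assumes "g \<in> carrier G" "h \<in> carrier G" "0 \<le> \<chi> g" "low B g" "low B h"
  shows "low B (g \<otimes>\<^bsub>G\<^esub> h)"
  unfolding low_def
proof (intro allI impI)
  fix r assume r: "r + \<chi> (g \<otimes>\<^bsub>G\<^esub> h) < B"
  have gh: "\<chi> (g \<otimes>\<^bsub>G\<^esub> h) = \<chi> g + \<chi> h"
    using assms by (simp add: character_mult[OF char])
  have "gact h (r, z) = (r + \<chi> h, z)"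
    using assms r by (simp add: low_def gh)
  moreover have "gact g (r + \<chi> h, z) = (r + \<chi> h + \<chi> g, z)"
    using assms(4) r by (simp add: low_def gh algebra_simps)
  ultimately show "gact (g \<otimes>\<^bsub>G\<^esub> h) (r, z) = (r + \<chi> (g \<otimes>\<^bsub>G\<^esub> h), z)"
    using assms by (simp add: gact_mult gh)
qed

lemma ex_low:
  assumes "g \<in> carrier G"
  shows "\<exists>B. low B g"
proof -
  obtain w where w: "w \<in> lists (V \<times> UNIV)" "g = cls w"
    using assms by (auto simp: artin_carrier)
  have "\<exists>B. \<forall>r<B. foldr act w (r, z) = (r + word_weight ht w, z)" for w
  proof (induction w)
    case (Cons l w)
    then obtain B where B: "\<And>r. r < B \<Longrightarrow> foldr act w (r, z) = (r + word_weight ht w, z)"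
      by blast
    obtain B' where B': "\<And>r. r < B' \<Longrightarrow> act l (r, z) = (r + letter_weight ht l, z)"
      using act_low by blast
    show ?case
      by (rule exI[of _ "min B (B' - word_weight ht w)"]) (simp add: B B')
  qed simp
  then obtain B where "\<And>r. r < B \<Longrightarrow> foldr act w (r, z) = (r + word_weight ht w, z)"
    by blast
  then have "low (B + \<chi> g) g"
    unfolding w(2) low_def using character_artin_class[OF char w(1)] by (simp add: gact_cls)
  then show ?thesis by blast
qed

text \<open>A bound \<open>B\<close> common to \<open>F\<close> and its inverses makes
  \<open>low B\<close> invariant along Cayley edges, so it holds for all elements of nonnegative
  height. Conjugating \<open>h\<close> by a power of \<open>b\<close> transports the question from
  \<open>r0\<close> to a point below \<open>B\<close>, where the conjugate, having height 0, fixes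
  the zero section.\<close>

lemma Sigma1_imp_fixes_zero_section:
  assumes \<Sigma>: "in_Sigma1 G \<chi>"
    and b: "b \<in> V" "ht b \<noteq> 0" "\<And>r. act (b, False) (r, z) = (r + ht b, z)"
    and h: "h \<in> lists (V \<times> UNIV)" "word_weight ht h = 0"
  shows "foldr act h (r0, z) = (r0, z)"
proof -
  let ?M = "{g \<in> carrier G. \<chi> g \<ge> 0}"
  obtain F where F: "finite F" "F \<subseteq> ?M" "cayley_connected G ?M F"
    using in_Sigma1_imp_cayley_connected[OF is_group char \<Sigma>] .
  obtain \<beta> where \<beta>: "\<And>g. g \<in> carrier G \<Longrightarrow> low (\<beta> g) g"
    using ex_low by metis
  \<comment> \<open>The extra 0 keeps the argument of \<open>Min\<close> nonempty when
    \<open>F\<close> is empty.\<close>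
  define B where "B = Min (insert 0 (\<beta> ` (F \<union> m_inv G ` F)))"
  have B: "low B f" "low B (inv\<^bsub>G\<^esub> f)" if f: "f \<in> F" for f
    using f F by (auto intro!: low_mono[OF \<beta>] simp: B_def)
  have "low B m \<longleftrightarrow> low B \<one>\<^bsub>G\<^esub>" if m: "m \<in> ?M" for m
  proof -
    have "low B (a \<otimes>\<^bsub>G\<^esub> f) \<longleftrightarrow> low B a" if a: "a \<in> ?M" and f: "f \<in> F" for a f
    proof
      have f': "f \<in> carrier G" "0 \<le> \<chi> f" using f F by auto
      show "low B (a \<otimes>\<^bsub>G\<^esub> f)" if "low B a"
        using low_mult that B[OF f] a f' by simp
      \<comment> \<open>Multiply back by \<open>inv f\<close>: the left factor \<open>a f\<close>
        has nonnegative height, as \<open>low_mult\<close> demands.\<close>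
      show "low B a" if "low B (a \<otimes>\<^bsub>G\<^esub> f)"
        using low_mult[of "a \<otimes>\<^bsub>G\<^esub> f" "inv\<^bsub>G\<^esub> f" B] that B[OF f] a f'
        by (simp add: m_assoc character_mult[OF char])
    qed
    then show ?thesis
      using F(3) m unfolding cayley_connected_def by (elim allE[of _ "low B"]) blast
  qed
  moreover have "low B \<one>\<^bsub>G\<^esub>"
    using character_one[OF is_monoid char] by (simp add: low_def artin_one gact_cls)
  ultimately have low_M: "low B m" if "m \<in> ?M" for m
    using that by blast
  have b': "act (b, True) (r, z) = (r - ht b, z)" for r
    using act_cancel[of b True "(r - ht b, z)"] b(3)[of "r - ht b"] by simp
  \<comment> \<open>The sign is such that \<open>g\<close> moves to the left and \<open>g'\<close>
    to the right, by \<open>\<bar>ht b\<bar>\<close> per letter.\<close>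
  define s where "s \<longleftrightarrow> 0 < ht b"
  have pow: "foldr act (replicate n (b, s')) (r, z) = (r + real n * letter_weight ht (b, s'), z)" for n r s'
    by (induction n) (auto simp: b b' algebra_simps)
  have wpow: "word_weight ht (replicate n (b, s')) = real n * letter_weight ht (b, s')" for n s'
    by (induction n) (auto simp: algebra_simps)
  obtain n :: nat where n: "r0 - B + 1 \<le> real n * \<bar>ht b\<bar>"
    using ex_nat_mult_ge b(2) by (metis zero_less_abs_iff)
  define g where "g = replicate n (b, s)"
  define g' where "g' = replicate n (b, \<not> s)"
  define r where "r = r0 - real n * \<bar>ht b\<bar>"
  have m_word: "g @ h @ g' \<in> lists (V \<times> UNIV)"
    using h(1) b(1) by (auto simp: g_def g'_def in_lists_conv_set)
  have "word_weight ht (g @ h @ g') = 0"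
    by (simp add: g_def g'_def wpow h(2))
  then have m: "cls (g @ h @ g') \<in> ?M" "\<chi> (cls (g @ h @ g')) = 0"
    using m_word by (auto simp: character_artin_class[OF char] artin_carrier)
  have "r < B" using n by (simp add: r_def)
  then have "foldr act g (foldr act h (foldr act g' (r, z))) = (r, z)"
    using low_M[OF m(1)] m(2) by (simp add: low_def gact_cls)
  moreover have g'r: "foldr act g' (r, z) = (r0, z)"
    unfolding g'_def pow using b(2) by (auto simp: r_def s_def abs_if)
  moreover have "foldr act g' (foldr act g p) = p" for p
  proof -
    have "rev (map (\<lambda>(v, b). (v, \<not> b)) g) = g'"
      by (simp add: g_def g'_def)
    then show ?thesis
      using foldr_act_artin_rel[OF artin_rel_cancel_word[of E lab g]] by (cases p) (simp add: fun_eq_iff)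
  qed
  \<comment> \<open>Applying \<open>g'\<close> cancels the leading \<open>g\<close>, so
    \<open>h\<close> sends \<open>(r0, z)\<close> to the image of \<open>(r, z)\<close> under
    \<open>g'\<close>, which is \<open>(r0, z)\<close>.\<close>
  ultimately show ?thesis by metis
qed

end

section \<open>Necessity of connectedness and dominance\<close>

context artin_character
begin

lemma word_weight_alt_word_swap:
  assumes e: "E u v"
  shows "word_weight ht (alt_word v u (lab u v)) = word_weight ht (alt_word u v (lab u v))"
proof (cases "even (lab u v)")
  case True
  then show ?thesis by (auto simp: word_weight_alt_word elim!: evenE)
next
  case False
  then show ?thesis using odd_edge_ht[OF e] by (simp add: word_weight_alt_word)
qed

end

section \<open>A twisted line bundle for a disconnected living subgraph\<close>

lemma alt_word_vertices: "l \<in> set (alt_word u v n) \<Longrightarrow> fst l = u \<or> fst l = v"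
  by (auto simp: alt_word_def split: if_splits)

lemma foldr_alt_word_even:
  "foldr f (alt_word u v (2 * k)) = (f (u, False) \<circ> f (v, False)) ^^ k"
  by (induction k) (auto simp: alt_word_Suc fun_eq_iff)

text \<open>Letters of the component \<open>C\<close> of \<open>a\<close> act by translation
  conjugated by multiplication with \<open>s\<close>, all others by plain translation; so relations
  within \<open>C\<close> or outside it hold. On an edge leaving \<open>C\<close>, either the outer
  end is dead and acts as the identity, or the edge is dead and both sides of its relation are the
  identity because \<open>p\<close> divides half the label. The commutator of \<open>a\<close> and
  \<open>b\<close> then moves the section 1.\<close>

lemma (in artin_character) in_Sigma1_imp_liv_connected:
  assumes \<Sigma>: "in_Sigma1 G \<chi>" and p: "1 < (p::nat)"
    and pdvd: "\<And>u v. E u v \<Longrightarrow> even (lab u v) \<Longrightarrow> 2 < lab u v \<Longrightarrow> p dvd lab u v div 2"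
    and a: "live_vertex V E lab \<chi> a" and b: "live_vertex V E lab \<chi> b"
  shows "(live_edge V E lab \<chi>)\<^sup>*\<^sup>* a b"
proof (rule ccontr)
  define C where "C = {v. (live_edge V E lab \<chi>)\<^sup>*\<^sup>* a v}"
  assume "\<not> (live_edge V E lab \<chi>)\<^sup>*\<^sup>* a b"
  then have bC: "b \<notin> C" and aC: "a \<in> C" by (auto simp: C_def)
  have live: "v \<in> V" "ht v \<noteq> 0" if "live_vertex V E lab \<chi> v" for v
    using that by (auto simp: live_vertex_def)
  have C_live: "live_vertex V E lab \<chi> v" if "v \<in> C" for v
  proof -
    have "(live_edge V E lab \<chi>)\<^sup>*\<^sup>* a v" using that by (simp add: C_def)
    then show ?thesis
      by (induction rule: rtranclp_induct) (auto simp: a live_edge_def)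
  qed
  define \<zeta> where "\<zeta> = cis (2 * pi / real p)"
  have \<zeta>p: "\<zeta> ^ p = 1"
    using p by (simp add: \<zeta>_def DeMoivre)
  have \<zeta>1: "\<zeta> \<noteq> 1"
  proof
    assume "\<zeta> = 1"
    then have c: "cos (2 * pi / real p) = 1"
      by (simp add: \<zeta>_def complex_eq_iff)
    have "0 < 2 * pi / real p" "2 * pi / real p \<le> pi"
      using p by (auto simp: field_simps)
    then have "cos (2 * pi / real p) < cos 0"
      by (intro cos_monotone_0_pi) auto
    with c show False by simp
  qed
  have \<zeta>0: "\<zeta> \<noteq> 0" by (simp add: \<zeta>_def)
  define s where "s = (\<lambda>r::real. if r = 0 then \<zeta> else 1)"
  have s0: "s r \<noteq> 0" and sp: "s r ^ p = 1" for r
    using \<zeta>p \<zeta>0 by (auto simp: s_def)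
  define act :: "'v \<times> bool \<Rightarrow> real \<times> complex \<Rightarrow> real \<times> complex" where
    "act = (\<lambda>l (r, x). (r + letter_weight ht l,
       if fst l \<in> C then x * s (r + letter_weight ht l) / s r else x))"
  have word_in: "foldr act w (r, x) = (r + word_weight ht w, x * s (r + word_weight ht w) / s r)"
    if "\<forall>l\<in>set w. fst l \<in> C" for w r x
    using that by (induction w) (auto simp: act_def s0 algebra_simps)
  have word_out: "foldr act w (r, x) = (r + word_weight ht w, x)"
    if "\<forall>l\<in>set w. fst l \<notin> C" for w r x
    using that by (induction w) (auto simp: act_def algebra_simps)
  have mixed: "foldr act (alt_word u v (lab u v)) = foldr act (alt_word v u (lab u v))"
    if e: "E u v" and u: "u \<in> C" and v: "v \<notin> C" for u v
  proof -
    have hu: "ht u \<noteq> 0" using C_live[OF u] live by blast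
    have "\<not> live_edge V E lab \<chi> u v"
      using u v by (auto simp: C_def dest: rtranclp.rtrancl_into_rtrancl)
    then have v_or: "ht v = 0 \<or> dead_edge E lab \<chi> u v"
      using C_live[OF u] e edgeD[OF e] by (auto simp: live_edge_def live_vertex_def)
    have "even (lab u v)"
      using v_or odd_edge_ht[OF e] hu by (cases "even (lab u v)") (auto simp: dead_edge_def)
    then obtain k where k: "lab u v = 2 * k" by blast
    show ?thesis
    proof (cases "ht v = 0")
      case True
      then have "act (v, False) = id"
        using v by (auto simp: act_def)
      then show ?thesis
        by (simp add: k foldr_alt_word_even)
    next
      case False
      with v_or have d: "dead_edge E lab \<chi> u v" by blast
      then have hv: "ht v = - ht u" and "p dvd k"
        using pdvd[OF e] k by (auto simp: dead_edge_def)
      then obtain j where j: "k = p * j" by blast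
      \<comment> \<open>A round trip along a dead edge returns to its fibre and multiplies by a
        quotient of two values of \<open>s\<close>, a \<open>p\<close>-th root of unity;
        \<open>p\<close> divides the number \<open>k\<close> of round trips.\<close>
      have rot: "f ^^ k = id" if f: "f = (\<lambda>(r, x). (r, x * q r))" and q: "\<And>r. q r ^ p = 1"
        for f :: "real \<times> complex \<Rightarrow> real \<times> complex" and q
      proof -
        have "(f ^^ n) (r, x) = (r, x * q r ^ n)" for n r x
          by (induction n) (auto simp: f)
        then show ?thesis
          by (auto simp: fun_eq_iff j power_mult q)
      qed
      have "(act (u, False) \<circ> act (v, False)) ^^ k = id"
        by (rule rot[where q = "\<lambda>r. s r / s (r - ht u)"])
          (use u v hv in \<open>auto simp: act_def fun_eq_iff power_divide sp\<close>)
      moreover have "(act (v, False) \<circ> act (u, False)) ^^ k = id"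
        by (rule rot[where q = "\<lambda>r. s (r + ht u) / s r"])
          (use u v hv in \<open>auto simp: act_def fun_eq_iff power_divide sp\<close>)
      ultimately show ?thesis
        by (simp add: k foldr_alt_word_even)
    qed
  qed
  interpret A: artin_action V E lab \<chi> act 1
  proof
    show "act (v, b) (act (v, \<not> b) p) = p" for v b p
      by (cases p) (auto simp: act_def s0)
    show "foldr act (alt_word u v (lab u v)) = foldr act (alt_word v u (lab u v))" if e: "E u v" for u v
    proof -
      consider "u \<in> C" "v \<in> C" | "u \<notin> C" "v \<notin> C" | "u \<in> C" "v \<notin> C" | "u \<notin> C" "v \<in> C"
        by blast
      then show ?thesis
      proof cases
        case 1
        then have "\<forall>l\<in>set (alt_word u v n). fst l \<in> C" "\<forall>l\<in>set (alt_word v u n). fst l \<in> C" for n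
          by (auto dest!: alt_word_vertices)
        then show ?thesis
          by (intro ext) (auto simp: word_in word_weight_alt_word_swap[OF e])
      next
        case 2
        then have "\<forall>l\<in>set (alt_word u v n). fst l \<notin> C" "\<forall>l\<in>set (alt_word v u n). fst l \<notin> C" for n
          by (auto dest!: alt_word_vertices)
        then show ?thesis
          by (intro ext) (auto simp: word_out word_weight_alt_word_swap[OF e])
      next
        case 3
        then show ?thesis using mixed[OF e] by simp
      next
        case 4
        then show ?thesis using mixed[of v u] edgeD[OF e] by simp
      qed
    qed
    \<comment> \<open>Below this bound both \<open>r\<close> and its translate are negative, hence
      away from the fibre over 0.\<close>
    show "\<exists>B. \<forall>r<B. act l (r, 1) = (r + letter_weight ht l, 1)" for l
      by (rule exI[of _ "- \<bar>letter_weight ht l\<bar>"]) (auto simp: act_def s_def)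
  qed
  define h where "h = [(a, False), (b, False), (a, True), (b, True)]"
  have "foldr act h (r, 1) = (r, 1)" for r
    using live[OF a] live[OF b] bC
    by (intro A.Sigma1_imp_fixes_zero_section[OF \<Sigma>, of b]) (auto simp: h_def act_def)
  then have h1: "s (r - ht b - ht a) / s (r - ht b) * s r / s (r - ht a) = 1" for r
    using aC bC by (simp add: h_def act_def algebra_simps)
  \<comment> \<open>Exactly one of the four arguments of \<open>s\<close> should be 0. At
    \<open>r = 0\<close> this fails if the heights cancel: the value is then \<zeta>^2, which is 1
    for \<open>p = 2\<close>. In that case \<open>r = ht a\<close> gives the value
    1/\<zeta>.\<close>
  show False
  proof (cases "ht a + ht b = 0")
    case False
    then show False
      using h1[of 0] live[OF a] live[OF b] \<zeta>1 by (auto simp: s_def)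
  next
    case True
    then show False
      using h1[of "ht a"] live[OF a] live[OF b] \<zeta>1 \<zeta>0 by (auto simp: s_def)
  qed
qed

section \<open>The reflection representation and dominance\<close>

text \<open>The coefficients with which an alternating product of two reflections moves a vector; they
  are partial sums of Chebyshev polynomials of the second kind.\<close>
fun alt_coeff :: "real \<Rightarrow> nat \<Rightarrow> real \<Rightarrow> real \<Rightarrow> real" where
  "alt_coeff c 0 x y = 0"
| "alt_coeff c (Suc 0) x y = x"
| "alt_coeff c (Suc (Suc n)) x y = x + 2 * c * alt_coeff c (Suc n) y x - alt_coeff c n x y"

text \<open>Up to the factor \<open>x\<close> or \<open>y\<close>, the differences are the Chebyshev
  polynomials U_n at cos \<theta>, that is sin ((n + 1) \<theta>) / sin \<theta>; multiplying by the
  sine avoids the division.\<close>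

lemma alt_coeff_Suc_diff:
  "(alt_coeff (cos \<theta>) (Suc n) x y - alt_coeff (cos \<theta>) n x y) * sin \<theta>
    = (if even n then x else y) * sin (real (Suc n) * \<theta>)"
proof (induction n arbitrary: x y rule: induct_nat_012)
  case 0
  show ?case by simp
next
  case 1
  show ?case by (simp add: sin_double)
next
  case (ge2 n)
  let ?d = "\<lambda>n x y. (alt_coeff (cos \<theta>) (Suc n) x y - alt_coeff (cos \<theta>) n x y) * sin \<theta>"
  have "?d (Suc (Suc n)) x y = 2 * cos \<theta> * ?d (Suc n) y x - ?d n x y"
    by (simp add: algebra_simps)
  also have "\<dots> = (if even n then x else y) *
      (2 * cos \<theta> * sin (real (Suc (Suc n)) * \<theta>) - sin (real (Suc n) * \<theta>))"
    using ge2 by (simp add: algebra_simps)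
  also have "2 * cos \<theta> * sin (real (Suc (Suc n)) * \<theta>) - sin (real (Suc n) * \<theta>)
      = sin (real (Suc (Suc (Suc n))) * \<theta>)"
  proof -
    let ?m = "real (Suc (Suc n)) * \<theta>"
    have "real (Suc (Suc (Suc n))) * \<theta> = ?m + \<theta>" "real (Suc n) * \<theta> = ?m - \<theta>"
      by (auto simp: algebra_simps)
    then show ?thesis
      by (simp only: sin_add sin_diff) (simp add: algebra_simps)
  qed
  finally show ?case by simp
qed

text \<open>Coordinates of the dual space: \<open>x y\<close> is the value of \<open>x\<close> on
  the simple root \<open>y\<close>. The row \<open>A v\<close> is the direction of the reflection,
  and the fundamental weight of \<open>v\<close> is the unit vector at \<open>v\<close>.\<close>

definition reflection :: "('v \<Rightarrow> 'v \<Rightarrow> real) \<Rightarrow> 'v \<Rightarrow> ('v \<Rightarrow> real) \<Rightarrow> 'v \<Rightarrow> real" where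
  "reflection A v x = (\<lambda>y. x y - A v y * x v)"

lemma reflection_involution: "A v v = 2 \<Longrightarrow> reflection A v (reflection A v x) = x"
  by (auto simp: reflection_def algebra_simps)

text \<open>A further reflection in \<open>u\<close> adds the current coordinate at \<open>u\<close>
  to the coefficient of \<open>A u\<close>; this is the recursion of
  \<open>alt_coeff\<close>.\<close>

lemma foldr_reflection_alt_word:
  assumes "A u u = 2" "A v v = 2" "A u v = - 2 * c" "A v u = - 2 * c"
  shows "foldr (\<lambda>l. reflection A (fst l)) (alt_word u v (Suc n)) x
    = (\<lambda>y. x y - A u y * alt_coeff c (Suc n) (x u) (x v) - A v y * alt_coeff c n (x v) (x u))"
  using assms
proof (induction n arbitrary: u v)
  case 0
  then show ?case by (simp add: alt_word_Suc reflection_def)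
next
  case (Suc n)
  have step: "foldr (\<lambda>l. reflection A (fst l)) (alt_word u v (Suc (Suc n))) x
      = reflection A u (foldr (\<lambda>l. reflection A (fst l)) (alt_word v u (Suc n)) x)"
    by (simp add: alt_word_Suc[of u v])
  show ?case
    unfolding step Suc.IH[OF Suc.prems(2,1,4,3)] using Suc.prems
    by (simp add: reflection_def algebra_simps)
qed

text \<open>At the angle \<pi> / m the last difference of the coefficients vanishes because sin
  \<pi> = 0, so both words subtract the same multiples of \<open>A u\<close> and
  \<open>A v\<close>.\<close>

lemma reflection_braid:
  assumes A: "A u u = 2" "A v v = 2" "A u v = - 2 * cos (pi / real m)" "A v u = - 2 * cos (pi / real m)"
    and m: "2 \<le> m"
  shows "foldr (\<lambda>l. reflection A (fst l)) (alt_word u v m) x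
    = foldr (\<lambda>l. reflection A (fst l)) (alt_word v u m) x"
proof -
  obtain k where k: "m = Suc k" using m by (cases m) auto
  have "0 < sin (pi / real m)"
    using m by (intro sin_gt_zero) (auto simp: field_simps)
  then have eq: "alt_coeff (cos (pi / real m)) (Suc k) x y = alt_coeff (cos (pi / real m)) k x y" for x y
    using alt_coeff_Suc_diff[of "pi / real m" k x y] m by (simp add: k)
  show ?thesis
    unfolding k using A by (simp add: foldr_reflection_alt_word[where c = "cos (pi / real m)"] eq algebra_simps)
qed

text \<open>If \<open>d\<close> and all its neighbours are dead, every relation involving
  \<open>d\<close> acts within the fibres. Over 0 both its sides are reflection words conjugated by
  the translation \<open>up\<close>, with which the reflections at other vertices commute. Relations
  avoiding \<open>d\<close> are those of the reflections. The letter \<open>d\<close> has height 0,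
  yet it moves the zero section over 0.\<close>

lemma (in artin_character) in_Sigma1_imp_liv_dominant:
  assumes \<Sigma>: "in_Sigma1 G \<chi>" and b: "live_vertex V E lab \<chi> b"
  shows "liv_dominant V E lab \<chi>"
  unfolding liv_dominant_def
proof (intro ballI impI, rule ccontr)
  fix d assume dV: "d \<in> V" and "\<not> live_vertex V E lab \<chi> d"
    and nex: "\<not> (\<exists>u. live_vertex V E lab \<chi> u \<and> E d u)"
  then have hd: "ht d = 0" by (simp add: live_vertex_def)
  have hnb: "ht u = 0" if "E d u" for u
    using nex that edgeD[OF that] by (auto simp: live_vertex_def)
  have hb: "b \<in> V" "ht b \<noteq> 0" "b \<noteq> d"
    using b hd by (auto simp: live_vertex_def)
  \<comment> \<open>On adjacent pairs and the diagonal this is twice the Tits form. No relation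
    joins distinct non-adjacent vertices, so their entry is free and set to 0.\<close>
  define A where "A = (\<lambda>u v. if u = v then 2 else if E u v then - 2 * cos (pi / real (lab u v)) else 0)"
  define R where "R = (\<lambda>l :: 'v \<times> bool. reflection A (fst l))"
  have RR: "reflection A v (reflection A v x) = x" for v x
    by (rule reflection_involution) (simp add: A_def)
  have R_braid: "foldr R (alt_word u v (lab u v)) x = foldr R (alt_word v u (lab u v)) x" if e: "E u v" for u v x
    unfolding R_def using edgeD[OF e] e by (intro reflection_braid) (auto simp: A_def)
  define up :: "('v \<Rightarrow> real) \<Rightarrow> 'v \<Rightarrow> real" where "up = (\<lambda>x. x(d := x d + 1))"
  define dn :: "('v \<Rightarrow> real) \<Rightarrow> 'v \<Rightarrow> real" where "dn = (\<lambda>x. x(d := x d - 1))"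
  have up_dn: "up (dn x) = x" "dn (up x) = x" for x
    by (auto simp: up_def dn_def)
  \<comment> \<open>\<open>up\<close> changes only the coordinate at \<open>d\<close>, while the
    multiple of \<open>A v\<close> subtracted by the reflection depends only on the coordinate at
    \<open>v\<close>.\<close>
  have up_comm: "dn (reflection A v (up x)) = reflection A v x" if "v \<noteq> d" for v x
    using that by (auto simp: up_def dn_def reflection_def)
  define act :: "'v \<times> bool \<Rightarrow> real \<times> ('v \<Rightarrow> real) \<Rightarrow> real \<times> ('v \<Rightarrow> real)" where
    "act = (\<lambda>l (r, x). (r + letter_weight ht l,
       if fst l = d \<and> r = 0 then dn (R l (up x)) else R l x))"
  have word_out: "foldr act w (r, x) = (r + word_weight ht w, foldr R w x)"
    if "\<forall>l\<in>set w. fst l \<noteq> d" for w r x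
    using that by (induction w) (auto simp: act_def)
  have word_in: "foldr act w (r, x) = (r, if r = 0 then dn (foldr R w (up x)) else foldr R w x)"
    if "\<forall>l\<in>set w. ht (fst l) = 0" for w r x
    using that
  proof (induction w)
    case Nil
    then show ?case by (simp add: up_dn)
  next
    case (Cons l w)
    then have "letter_weight ht l = 0" by (cases l) simp
    with Cons show ?case
      using up_comm[of "fst l" "dn (foldr R w (up x))"] by (auto simp: act_def up_dn R_def)
  qed
  interpret B: artin_action V E lab \<chi> act "\<lambda>_. 0"
  proof
    show "act (v, b) (act (v, \<not> b) p) = p" for v b p
      using hd by (cases p) (auto simp: act_def R_def RR up_dn)
    show "foldr act (alt_word u v (lab u v)) = foldr act (alt_word v u (lab u v))" if e: "E u v" for u v
    proof (cases "u = d \<or> v = d")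
      case True
      then have "ht u = 0" "ht v = 0"
        using hd hnb e edgeD[OF e] by auto
      then have "\<forall>l\<in>set (alt_word u v n). ht (fst l) = 0" "\<forall>l\<in>set (alt_word v u n). ht (fst l) = 0" for n
        by (auto dest!: alt_word_vertices)
      then show ?thesis
        by (intro ext) (auto simp: word_in R_braid[OF e])
    next
      case False
      then have "\<forall>l\<in>set (alt_word u v n). fst l \<noteq> d" "\<forall>l\<in>set (alt_word v u n). fst l \<noteq> d" for n
        by (auto dest!: alt_word_vertices)
      then show ?thesis
        by (intro ext) (auto simp: word_out R_braid[OF e] word_weight_alt_word_swap[OF e])
    qed
    show "\<exists>B. \<forall>r<B. act l (r, \<lambda>_. 0) = (r + letter_weight ht l, \<lambda>_. 0)" for l
      by (rule exI[of _ 0]) (auto simp: act_def R_def reflection_def)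
  qed
  have "foldr act [(d, False)] (0, \<lambda>_. 0) = (0, \<lambda>_. 0)"
    using hb hd dV
    by (intro B.Sigma1_imp_fixes_zero_section[OF \<Sigma>, of b]) (auto simp: act_def R_def reflection_def)
  \<comment> \<open>The coordinate at \<open>d\<close> in fact goes from 0 to 1, then to -1, then to
    -2.\<close>
  then have "dn (reflection A d (up (\<lambda>_. 0))) d = 0"
    using hd by (simp add: act_def R_def)
  then show False
    by (simp add: dn_def up_def reflection_def A_def)
qed

section \<open>Assembling both implications\<close>

theorem theorem1p3:
  fixes V :: "'v set" and E :: "'v \<Rightarrow> 'v \<Rightarrow> bool" and lab :: "'v \<Rightarrow> 'v \<Rightarrow> nat"
    and \<chi> :: "('v \<times> bool) list set \<Rightarrow> real"
  assumes "labelled_graph V E lab"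
    and "\<exists>p::nat. prime p \<and> (\<forall>u v. E u v \<and> even (lab u v) \<and> lab u v > 2 \<longrightarrow> p dvd (lab u v div 2))"
    and "character (artin_group V E lab) \<chi>"
    and "\<exists>g\<in>carrier (artin_group V E lab). \<chi> g \<noteq> 0"
  shows "in_Sigma1 (artin_group V E lab) \<chi> \<longleftrightarrow>
           liv_connected V E lab \<chi> \<and> liv_dominant V E lab \<chi>"
proof
  interpret artin_character V E lab \<chi>
    using assms by unfold_locales
  show "in_Sigma1 (artin_group V E lab) \<chi>"
    if "liv_connected V E lab \<chi> \<and> liv_dominant V E lab \<chi>"
    using that in_Sigma1_if_liv_connected_dominant by blast
  assume \<Sigma>: "in_Sigma1 (artin_group V E lab) \<chi>"
  obtain p :: nat where p: "prime p"
    and pdvd: "\<And>u v. E u v \<Longrightarrow> even (lab u v) \<Longrightarrow> 2 < lab u v \<Longrightarrow> p dvd lab u v div 2"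
    using assms(2) by blast
  \<comment> \<open>\<open>liv_connected\<close> demands a living vertex; if all generators had
    height 0, so would all words.\<close>
  have "\<exists>b. live_vertex V E lab \<chi> b"
  proof (rule ccontr)
    assume "\<not> ?thesis"
    then have "ht v = 0" if "v \<in> V" for v
      using that by (auto simp: live_vertex_def)
    then have "word_weight ht w = 0" if "w \<in> lists (V \<times> UNIV)" for w
      using that by (induction w) auto
    with assms(4) show False
      by (auto simp: artin_carrier character_artin_class[OF char])
  qed
  then obtain b where b: "live_vertex V E lab \<chi> b" by blast
  show "liv_connected V E lab \<chi> \<and> liv_dominant V E lab \<chi>"
    using in_Sigma1_imp_liv_connected[OF \<Sigma> prime_gt_1_nat[OF p] pdvd]
      in_Sigma1_imp_liv_dominant[OF \<Sigma> b] b
    by (auto simp: liv_connected_def)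
qed

end
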